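(* Fix $1\le p_0<\infty$ and $\mathbb B\in O(p_0,\infty)$. Let $f\in L^{p_0}_{loc}(\mathbb R^n)$ and let $a$ be a functional with $a\in D_\infty$ such that $(\fint_{2^kQ}|B_Qf|^{p_0}dx)^{1/p_0}\le a(2^kQ)$ for every integer $k\ge0$ and every cube $Q$. Set $\eta_1=1$, $\eta_k=\alpha_k$ for $k=2,3,4$ and $\eta_k=\max\{\alpha_k,\alpha_{k-3}\}$ for $k\ge5$. Then for every cube $Q$, $$\|B_Qf\|_{\exp L,Q}\le C\sum_{k\ge1}\eta_k\,a(2^kQ),$$ and, for every $w\in A_\infty$, $$\|B_Qf\|_{\exp L(w),Q}\le C_w\sum_{k\ge1}\eta_k\,a(2^kQ),$$ with $C,C_w$ independent of $Q$ and $f$.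
   Context: Cubes $Q=\prod_i[a_i,a_i+\ell(Q))$; $\lambda Q$ is the concentric cube of sidelength $\lambda\ell(Q)$; $\mathcal Q$ is the set of all cubes; $\fint_Eg=|E|^{-1}\int_Eg$. $\|g\|_{\exp L,Q}=\inf\{\lambda>0:\fint_Q(\exp(|g|/\lambda)-1)dx\le1\}$, and $\|g\|_{\exp L(w),Q}$ is defined the same way with $dx/|Q|$ replaced by $w\,dx/w(Q)$. $A_\infty$ is the union of the Muckenhoupt classes $A_p$. A functional is a map $a:\mathcal Q\to[0,\infty)$; $a\in D_\infty$ means there is $C\ge1$ with $a(R)\le Ca(Q)$ for all cubes $R\subset Q$. $\mathbb B=(B_Q)$ are linear operators on $L^{p_0}_{loc}(\mathbb R^n)$, $A_Q=I-B_Q$; $\mathbb B\in O(p_0,\infty)$ means: (a) $B_QB_R=B_RB_Q$ for all $Q,R$; (b) $\|B_Qf\|_{L^{p_0}(\mathbb R^n)}\le C_{p_0}\|f\|_{L^{p_0}(\mathbb R^n)}$ for all $Q$; (c) there are $\alpha_k\ge0$ ($k\ge2$) with $\sum_k2^{kn/p_0}\alpha_k<\infty$ such that $\operatorname{ess\,sup}_{2Q}|A_Q(f\chi_{4Q})|\le\alpha_2(\fint_{4Q}|f|^{p_0})^{1/p_0}$ and, for $j\ge1$, $\operatorname{ess\,sup}_{2^jQ}|A_Q(f\chi_{\mathbb R^n\setminus2^{j+1}Q})|\le\sum_{k\ge2}\alpha_{k+j}(\fint_{2^{k+j}Q}|f|^{p_0})^{1/p_0}$; (d) there are $\beta_k\ge0$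 with $\sum\beta_k<\infty$ such that for cubes $R\subset Q$, $\operatorname{ess\,sup}_{2R}|B_RA_Qf|\le\sum_{k\ge1}\beta_{k+1}(\fint_{2^{k+1}Q}|f|^{p_0})^{1/p_0}$. *)

theory Defs
  imports "HOL-Analysis.Analysis"
begin

text \<open>A cube is encoded by its parameters (a, l): the corner a and the side length l > 0;
  the associated set is the half-open product of the intervals [a_i, a_i + l).\<close>

type_synonym 'n cube = "(real^'n) \<times> real"

definition is_cube :: "'n::finite cube \<Rightarrow> bool" where
  "is_cube Q \<longleftrightarrow> snd Q > 0"

definition cube_set :: "'n::finite cube \<Rightarrow> (real^'n) set" where
  "cube_set Q = {x. \<forall>i. fst Q $ i \<le> x $ i \<and> x $ i < fst Q $ i + snd Q}"

text \<open>Concentric dilate t Q of sidelength t * l(Q).\<close>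
definition dil :: "real \<Rightarrow> 'n::finite cube \<Rightarrow> 'n cube" where
  "dil t Q = ((\<chi> i. fst Q $ i + (1 - t) * snd Q / 2), t * snd Q)"

definition avgp :: "real \<Rightarrow> 'n::finite cube \<Rightarrow> (real^'n \<Rightarrow> real) \<Rightarrow> real" where
  "avgp p Q g = ((\<integral>x\<in>cube_set Q. \<bar>g x\<bar> powr p \<partial>lebesgue) / measure lebesgue (cube_set Q)) powr (1 / p)"

definition Lloc :: "real \<Rightarrow> (real^'n::finite \<Rightarrow> real) \<Rightarrow> bool" where
  "Lloc p f \<longleftrightarrow> f \<in> borel_measurable lebesgue \<and>
     (\<forall>Q. is_cube Q \<longrightarrow> set_integrable lebesgue (cube_set Q) (\<lambda>x. \<bar>f x\<bar> powr p))"

definition Lp :: "real \<Rightarrow> (real^'n::finite \<Rightarrow> real) \<Rightarrow> bool" where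
  "Lp p f \<longleftrightarrow> f \<in> borel_measurable lebesgue \<and> integrable lebesgue (\<lambda>x. \<bar>f x\<bar> powr p)"

definition Lp_norm :: "real \<Rightarrow> (real^'n::finite \<Rightarrow> real) \<Rightarrow> real" where
  "Lp_norm p f = (\<integral>x. \<bar>f x\<bar> powr p \<partial>lebesgue) powr (1 / p)"

text \<open>A family of linear operators on L^p_loc (acting on representatives, compatible with
  a.e. equality).\<close>
definition linear_Lloc_ops :: "real \<Rightarrow> ('n::finite cube \<Rightarrow> (real^'n \<Rightarrow> real) \<Rightarrow> (real^'n \<Rightarrow> real)) \<Rightarrow> bool" where
  "linear_Lloc_ops p B \<longleftrightarrow> (\<forall>Q. is_cube Q \<longrightarrow>
     (\<forall>f. Lloc p f \<longrightarrow> Lloc p (B Q f)) \<and>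
     (\<forall>f g. Lloc p f \<longrightarrow> Lloc p g \<longrightarrow> (AE x in lebesgue. f x = g x) \<longrightarrow>
        (AE x in lebesgue. B Q f x = B Q g x)) \<and>
     (\<forall>f g. Lloc p f \<longrightarrow> Lloc p g \<longrightarrow>
        (AE x in lebesgue. B Q (\<lambda>y. f y + g y) x = B Q f x + B Q g x)) \<and>
     (\<forall>f c. Lloc p f \<longrightarrow> (AE x in lebesgue. B Q (\<lambda>y. c * f y) x = c * B Q f x)))"

definition O_class :: "real \<Rightarrow> ('n::finite cube \<Rightarrow> (real^'n \<Rightarrow> real) \<Rightarrow> (real^'n \<Rightarrow> real))
    \<Rightarrow> (nat \<Rightarrow> real) \<Rightarrow> (nat \<Rightarrow> real) \<Rightarrow> bool" where
  "O_class p0 B \<alpha> \<beta> \<longleftrightarrow>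
     linear_Lloc_ops p0 B \<and>
     \<comment> \<open>(a) commutation\<close>
     (\<forall>Q R f. is_cube Q \<longrightarrow> is_cube R \<longrightarrow> Lloc p0 f \<longrightarrow>
        (AE x in lebesgue. B Q (B R f) x = B R (B Q f) x)) \<and>
     \<comment> \<open>(b) uniform L^p0 bound\<close>
     (\<exists>Cp. \<forall>Q f. is_cube Q \<longrightarrow> Lp p0 f \<longrightarrow> Lloc p0 f \<longrightarrow>
        Lp p0 (B Q f) \<and> Lp_norm p0 (B Q f) \<le> Cp * Lp_norm p0 f) \<and>
     \<comment> \<open>(c) off-diagonal estimates for A_Q = I - B_Q\<close>
     (\<forall>k\<ge>2. \<alpha> k \<ge> 0) \<and>
     summable (\<lambda>k. 2 powr (real k * real CARD('n) / p0) * \<alpha> k) \<and>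
     (\<forall>Q f. is_cube Q \<longrightarrow> Lloc p0 f \<longrightarrow>
        (AE x in lebesgue. x \<in> cube_set (dil 2 Q) \<longrightarrow>
           \<bar>indicator (cube_set (dil 4 Q)) x * f x
              - B Q (\<lambda>y. indicator (cube_set (dil 4 Q)) y * f y) x\<bar>
           \<le> \<alpha> 2 * avgp p0 (dil 4 Q) f)) \<and>
     (\<forall>Q f j. is_cube Q \<longrightarrow> Lloc p0 f \<longrightarrow> j \<ge> 1 \<longrightarrow>
        (AE x in lebesgue. x \<in> cube_set (dil (2 ^ j) Q) \<longrightarrow>
           ennreal \<bar>indicator (- cube_set (dil (2 ^ (j + 1)) Q)) x * f x
              - B Q (\<lambda>y. indicator (- cube_set (dil (2 ^ (j + 1)) Q)) y * f y) x\<bar>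
           \<le> (\<Sum>k. ennreal (\<alpha> (k + 2 + j) * avgp p0 (dil (2 ^ (k + 2 + j)) Q) f)))) \<and>
     \<comment> \<open>(d)\<close>
     (\<forall>k. \<beta> k \<ge> 0) \<and> summable \<beta> \<and>
     (\<forall>Q R f. is_cube Q \<longrightarrow> is_cube R \<longrightarrow> cube_set R \<subseteq> cube_set Q \<longrightarrow> Lloc p0 f \<longrightarrow>
        (AE x in lebesgue. x \<in> cube_set (dil 2 R) \<longrightarrow>
           ennreal \<bar>B R (\<lambda>y. f y - B Q f y) x\<bar>
           \<le> (\<Sum>k. ennreal (\<beta> (k + 2) * avgp p0 (dil (2 ^ (k + 2)) Q) f))))"

definition D_inf_const :: "real \<Rightarrow> ('n::finite cube \<Rightarrow> real) \<Rightarrow> bool" where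
  "D_inf_const C a \<longleftrightarrow> C \<ge> 1 \<and> (\<forall>Q. is_cube Q \<longrightarrow> a Q \<ge> 0) \<and>
     (\<forall>Q R. is_cube Q \<longrightarrow> is_cube R \<longrightarrow> cube_set R \<subseteq> cube_set Q \<longrightarrow> a R \<le> C * a Q)"

text \<open>Luxemburg norms of exp L type (value \<infinity> if no admissible lambda).\<close>
definition expL_norm :: "'n::finite cube \<Rightarrow> (real^'n \<Rightarrow> real) \<Rightarrow> ennreal" where
  "expL_norm Q g = Inf {ennreal t | t. t > 0 \<and>
     (\<integral>\<^sup>+x\<in>cube_set Q. ennreal (exp (\<bar>g x\<bar> / t) - 1) \<partial>lebesgue) \<le> emeasure lebesgue (cube_set Q)}"

definition expLw_norm :: "(real^'n::finite \<Rightarrow> real) \<Rightarrow> 'n cube \<Rightarrow> (real^'n \<Rightarrow> real) \<Rightarrow> ennreal" where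
  "expLw_norm w Q g = Inf {ennreal t | t. t > 0 \<and>
     (\<integral>\<^sup>+x\<in>cube_set Q. ennreal ((exp (\<bar>g x\<bar> / t) - 1) * w x) \<partial>lebesgue)
       \<le> (\<integral>\<^sup>+x\<in>cube_set Q. ennreal (w x) \<partial>lebesgue)}"

definition weight :: "(real^'n::finite \<Rightarrow> real) \<Rightarrow> bool" where
  "weight w \<longleftrightarrow> w \<in> borel_measurable lebesgue \<and> (\<forall>x. w x \<ge> 0) \<and>
     (AE x in lebesgue. w x > 0) \<and>
     (\<forall>Q. is_cube Q \<longrightarrow> set_integrable lebesgue (cube_set Q) w)"

definition avg :: "'n::finite cube \<Rightarrow> (real^'n \<Rightarrow> real) \<Rightarrow> real" where
  "avg Q g = (\<integral>x\<in>cube_set Q. g x \<partial>lebesgue) / measure lebesgue (cube_set Q)"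

definition A1 :: "(real^'n::finite \<Rightarrow> real) \<Rightarrow> bool" where
  "A1 w \<longleftrightarrow> weight w \<and> (\<exists>C. \<forall>Q. is_cube Q \<longrightarrow>
     (AE x in lebesgue. x \<in> cube_set Q \<longrightarrow> avg Q w \<le> C * w x))"

definition Ap :: "real \<Rightarrow> (real^'n::finite \<Rightarrow> real) \<Rightarrow> bool" where
  "Ap p w \<longleftrightarrow> p > 1 \<and> weight w \<and>
     (\<forall>Q. is_cube Q \<longrightarrow> set_integrable lebesgue (cube_set Q) (\<lambda>x. w x powr (- 1 / (p - 1)))) \<and>
     (\<exists>C. \<forall>Q. is_cube Q \<longrightarrow>
        avg Q w * (avg Q (\<lambda>x. w x powr (- 1 / (p - 1)))) powr (p - 1) \<le> C)"

definition A_inf :: "(real^'n::finite \<Rightarrow> real) \<Rightarrow> bool" where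
  "A_inf w \<longleftrightarrow> A1 w \<or> (\<exists>p>1. Ap p w)"

definition eta :: "(nat \<Rightarrow> real) \<Rightarrow> nat \<Rightarrow> real" where
  "eta \<alpha> k = (if k = 1 then 1 else if k \<le> 4 then \<alpha> k else max (\<alpha> k) (\<alpha> (k - 3)))"

end

(* Oscillations are compared at two scales.  If R is a dyadic subcube of Q, then
   B_Q f = B_R f - A_Q B_R f + A_R B_Q f because the operators commute.  On R the second term is
   controlled by the averages of B_R f over dilates of Q, each comparable to a dilate of R, and hence
   by the functional.  The third term is controlled by averages of B_Q f over dilates of R: the small
   ones are bounded when R is a maximal dyadic cube on whose double the average of B_Q f exceeds a
   level, and the large ones sit in dilates of Q.  So, outside a family of stopping cubes covering at
   most half of Q, B_Q f is bounded by a constant times T = sum_k eta_k a(2^k Q), while on each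
   stopping cube R it differs from B_R f by at most that constant.  By D_infinity the same T serves
   all subcubes, and iterating gives |{x in Q : |B_Q f| > N M}| <= 2^(-N) |Q| with M comparable to T.
   For a weight it suffices that sets of at most half the measure of a cube carry at most a fixed
   fraction theta < 1 of its weight. *)

theory Submission
  imports Defs
begin

text \<open>Two features of the hypotheses shape the proof. The off-diagonal estimates average over
  concentric dilates. A dilate 2^k R of a dyadic cube R need not lie in the dyadic ancestor of the
  same side, only in the double of that ancestor, so the stopping rule has to test doubles. Doubles
  of disjoint cubes overlap, so the size of the bad set cannot be found by adding up averages over
  disjoint cubes; a weak type bound for the maximal function over doubles takes the place of that
  count. Moreover, \<open>a\<close> bounds B_R f only on dilates of R itself. Enclosing dilates of Q
  in dilates of R, and these again in dilates of Q, costs scales. This is the origin of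
  \<open>eta\<close>: the entry \<alpha> (k - 3) pays for the lost scales, and the entry 1 at k = 1
  pays for the average of B_Q f over 2Q with which the stopping time starts. Every cube met in the
  iteration is compared with the original Q directly, so the constant of D_infinity enters the
  threshold once and not once per generation. This keeps the threshold N M linear in N.\<close>

subsection \<open>Cubes\<close>

lemma mem_cube_set:
  "x \<in> cube_set Q \<longleftrightarrow> (\<forall>i. fst Q $ i \<le> x $ i \<and> x $ i < fst Q $ i + snd Q)"
  by (simp add: cube_set_def)

lemma cube_set_borel [measurable]: "cube_set Q \<in> sets borel"
  unfolding cube_set_def by measurable

lemma cube_set_lebesgue [measurable]: "cube_set Q \<in> sets lebesgue"
  using cube_set_borel[of Q] by (metis sets_completionI_sets sets_lborel)

lemma cube_set_between:
  fixes Q :: "'n::finite cube"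
  shows "box (fst Q) (\<chi> i. fst Q $ i + snd Q) \<subseteq> cube_set Q"
    and "cube_set Q \<subseteq> cbox (fst Q) (\<chi> i. fst Q $ i + snd Q)"
  by (auto simp: cube_set_def mem_box_cart less_imp_le)

text \<open>The half-open cube lies between an open and a closed box of the same volume.\<close>

lemma emeasure_cube_set:
  fixes Q :: "'n::finite cube"
  assumes "is_cube Q"
  shows "emeasure lebesgue (cube_set Q) = ennreal (snd Q ^ CARD('n))"
proof -
  let ?u = "(\<chi> i. fst Q $ i + snd Q) :: real^'n"
  have Q: "snd Q > 0"
    using assms by (simp add: is_cube_def)
  have ne: "cbox (fst Q) ?u \<noteq> {}"
    using Q by (simp add: interval_ne_empty_cart less_imp_le)
  have "measure lborel (cbox (fst Q) ?u) = snd Q ^ CARD('n)"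
    using content_cbox_cart[OF ne] by simp
  then have 1: "emeasure lebesgue (cbox (fst Q) ?u) = ennreal (snd Q ^ CARD('n))"
    using emeasure_eq_ennreal_measure[of lborel "cbox (fst Q) ?u"] emeasure_lborel_cbox_finite[of "fst Q" ?u]
    by simp
  have 2: "emeasure lebesgue (box (fst Q) ?u) = emeasure lebesgue (cbox (fst Q) ?u)"
    by (simp add: emeasure_lborel_box_eq emeasure_lborel_cbox_eq)
  have "emeasure lebesgue (box (fst Q) ?u) \<le> emeasure lebesgue (cube_set Q)"
    "emeasure lebesgue (cube_set Q) \<le> emeasure lebesgue (cbox (fst Q) ?u)"
    by (intro emeasure_mono; use cube_set_between[of Q] in simp)+
  then show ?thesis
    using 1 2 by simp
qed

lemma measure_cube_set:
  fixes Q :: "'n::finite cube"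
  assumes "is_cube Q"
  shows "measure lebesgue (cube_set Q) = snd Q ^ CARD('n)"
  using emeasure_cube_set[OF assms] assms
  by (simp add: measure_def is_cube_def less_imp_le)

lemma cube_set_subset_iff:
  fixes R Q :: "'n::finite cube"
  assumes "is_cube R"
  shows "cube_set R \<subseteq> cube_set Q \<longleftrightarrow>
    (\<forall>i. fst Q $ i \<le> fst R $ i \<and> fst R $ i + snd R \<le> fst Q $ i + snd Q)"
proof (intro iffI allI)
  fix i
  assume sub: "cube_set R \<subseteq> cube_set Q"
  have R: "snd R > 0"
    using assms by (simp add: is_cube_def)
  have lo: "fst Q $ j \<le> fst R $ j \<and> fst R $ j < fst Q $ j + snd Q" for j
  proof -
    have "fst R \<in> cube_set R"
      using R by (simp add: mem_cube_set)
    then show ?thesis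
      using sub mem_cube_set[of "fst R" Q] by blast
  qed
  moreover have "fst R $ i + snd R \<le> fst Q $ i + snd Q"
  proof (rule ccontr)
    assume nle: "\<not> fst R $ i + snd R \<le> fst Q $ i + snd Q"
    \<comment> \<open>The corner of R with its i-th coordinate moved to the upper face of Q: a point
      of R that the half-open Q excludes.\<close>
    define y :: "real^'n" where "y = (\<chi> j. if j = i then fst Q $ i + snd Q else fst R $ j)"
    have "y \<in> cube_set R"
      using R nle lo[of i] by (auto simp: mem_cube_set y_def)
    then have "y \<in> cube_set Q"
      using sub by blast
    then have "y $ i < fst Q $ i + snd Q"
      by (simp add: mem_cube_set)
    then show False
      by (simp add: y_def)
  qed
  ultimately show "fst Q $ i \<le> fst R $ i \<and> fst R $ i + snd R \<le> fst Q $ i + snd Q"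
    by blast
next
  assume *: "\<forall>i. fst Q $ i \<le> fst R $ i \<and> fst R $ i + snd R \<le> fst Q $ i + snd Q"
  show "cube_set R \<subseteq> cube_set Q"
  proof
    fix x
    assume x: "x \<in> cube_set R"
    have "fst Q $ i \<le> x $ i \<and> x $ i < fst Q $ i + snd Q" for i
      using * x[unfolded mem_cube_set] by (meson less_le_trans order_trans)
    then show "x \<in> cube_set Q"
      by (simp add: mem_cube_set)
  qed
qed

lemma is_cube_dil [simp]: "t > 0 \<Longrightarrow> is_cube (dil t Q) \<longleftrightarrow> is_cube Q"
  by (simp add: is_cube_def dil_def zero_less_mult_iff)

lemma snd_dil [simp]: "snd (dil t Q) = t * snd Q"
  by (simp add: dil_def)

lemma fst_dil [simp]: "fst (dil t Q) $ i = fst Q $ i + (1 - t) * snd Q / 2"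
  by (simp add: dil_def)

text \<open>Dilation adds a margin of (t - 1) / 2 times the side at every face. For t \<ge> 1 the
  smaller cube receives the smaller margin.\<close>

lemma dil_mono:
  fixes R Q :: "'n::finite cube"
  assumes R: "is_cube R" and sub: "cube_set R \<subseteq> cube_set Q" and t: "t \<ge> 1"
  shows "cube_set (dil t R) \<subseteq> cube_set (dil t Q)"
proof -
  have *: "fst Q $ i \<le> fst R $ i \<and> fst R $ i + snd R \<le> fst Q $ i + snd Q" for i
    using sub cube_set_subset_iff[OF R] by blast
  \<comment> \<open>Any coordinate compares the sides; index types are inhabited, so
    \<open>undefined\<close> serves as one.\<close>
  have le: "snd R \<le> snd Q"
    using *[of undefined] by linarith
  have tl: "(t - 1) * snd R \<le> (t - 1) * snd Q"
    using le t by (simp add: mult_left_mono)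
  show ?thesis
  proof (subst cube_set_subset_iff)
    show "is_cube (dil t R)"
      using R t by simp
    show "\<forall>i. fst (dil t Q) $ i \<le> fst (dil t R) $ i \<and>
      fst (dil t R) $ i + snd (dil t R) \<le> fst (dil t Q) $ i + snd (dil t Q)"
    proof
      fix i
      show "fst (dil t Q) $ i \<le> fst (dil t R) $ i \<and>
        fst (dil t R) $ i + snd (dil t R) \<le> fst (dil t Q) $ i + snd (dil t Q)"
        using *[of i] tl by (simp add: algebra_simps add_divide_distrib diff_divide_distrib)
    qed
  qed
qed

text \<open>The centres of nested cubes differ by at most half the side of the larger one, so every
  dilate of one is contained in a slightly larger dilate of the other.\<close>

lemma dil_subset_dil:
  fixes R Q :: "'n::finite cube"
  assumes R: "is_cube R" and Q: "is_cube Q" and sub: "cube_set R \<subseteq> cube_set Q"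
    and s: "s > 0" and st: "s * snd R + snd Q \<le> t * snd Q"
  shows "cube_set (dil s R) \<subseteq> cube_set (dil t Q)"
proof -
  have *: "fst Q $ i \<le> fst R $ i \<and> fst R $ i + snd R \<le> fst Q $ i + snd Q" for i
    using sub cube_set_subset_iff[OF R] by blast
  have pos: "snd R > 0" "snd Q > 0"
    using R Q by (auto simp: is_cube_def)
  show ?thesis
  proof (subst cube_set_subset_iff)
    show "is_cube (dil s R)"
      using R s by simp
    show "\<forall>i. fst (dil t Q) $ i \<le> fst (dil s R) $ i \<and>
      fst (dil s R) $ i + snd (dil s R) \<le> fst (dil t Q) $ i + snd (dil t Q)"
    proof
      fix i
      show "fst (dil t Q) $ i \<le> fst (dil s R) $ i \<and>
        fst (dil s R) $ i + snd (dil s R) \<le> fst (dil t Q) $ i + snd (dil t Q)"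
        using *[of i] st pos by (simp add: field_simps)
    qed
  qed
qed

lemma dil_supset_dil:
  fixes R Q :: "'n::finite cube"
  assumes R: "is_cube R" and Q: "is_cube Q" and sub: "cube_set R \<subseteq> cube_set Q"
    and t: "t > 0" and st: "t * snd Q + snd Q \<le> s * snd R"
  shows "cube_set (dil t Q) \<subseteq> cube_set (dil s R)"
proof -
  have *: "fst Q $ i \<le> fst R $ i \<and> fst R $ i + snd R \<le> fst Q $ i + snd Q" for i
    using sub cube_set_subset_iff[OF R] by blast
  have pos: "snd R > 0" "snd Q > 0"
    using R Q by (auto simp: is_cube_def)
  show ?thesis
  proof (subst cube_set_subset_iff)
    show "is_cube (dil t Q)"
      using Q t by simp
    show "\<forall>i. fst (dil s R) $ i \<le> fst (dil t Q) $ i \<and>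
      fst (dil t Q) $ i + snd (dil t Q) \<le> fst (dil s R) $ i + snd (dil s R)"
    proof
      fix i
      show "fst (dil s R) $ i \<le> fst (dil t Q) $ i \<and>
      fst (dil t Q) $ i + snd (dil t Q) \<le> fst (dil s R) $ i + snd (dil s R)"
        using *[of i] st pos by (simp add: field_simps)
    qed
  qed
qed

subsection \<open>Dyadic subcubes\<close>

text \<open>Dyadic cubes are addressed by generation and by a point they contain. Membership then
  becomes equality of integer vectors, and nesting becomes integer division. The point may lie
  anywhere, so the grid extends beyond Q.\<close>

definition dyadic_index :: "'n::finite cube \<Rightarrow> nat \<Rightarrow> real^'n \<Rightarrow> 'n \<Rightarrow> int" where
  "dyadic_index Q m x i = \<lfloor>(x $ i - fst Q $ i) / snd Q * 2 ^ m\<rfloor>"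

definition dyadic_cube :: "'n::finite cube \<Rightarrow> nat \<Rightarrow> real^'n \<Rightarrow> 'n cube" where
  "dyadic_cube Q m x =
     ((\<chi> i. fst Q $ i + of_int (dyadic_index Q m x i) * (snd Q / 2 ^ m)), snd Q / 2 ^ m)"

lemma snd_dyadic_cube [simp]: "snd (dyadic_cube Q m x) = snd Q / 2 ^ m"
  by (simp add: dyadic_cube_def)

lemma is_cube_dyadic [simp]: "is_cube (dyadic_cube Q m x) \<longleftrightarrow> is_cube Q"
  by (simp add: is_cube_def zero_less_divide_iff)

lemma mem_dyadic_cube:
  assumes "is_cube Q"
  shows "y \<in> cube_set (dyadic_cube Q m x) \<longleftrightarrow> dyadic_index Q m y = dyadic_index Q m x"
proof -
  have Q: "snd Q > 0"
    using assms by (simp add: is_cube_def)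
  define s where "s = snd Q / 2 ^ m"
  have s: "s > 0"
    using Q by (simp add: s_def)
  have "dyadic_index Q m y i = k \<longleftrightarrow>
      fst Q $ i + of_int k * s \<le> y $ i \<and> y $ i < fst Q $ i + of_int k * s + s" for i k
  proof -
    have "dyadic_index Q m y i = \<lfloor>(y $ i - fst Q $ i) / s\<rfloor>"
      by (simp add: dyadic_index_def s_def)
    then show ?thesis
      by (simp add: floor_eq_iff pos_le_divide_eq[OF s] pos_divide_less_eq[OF s] distrib_right)
        linarith
  qed
  then show ?thesis
    by (auto simp: mem_cube_set dyadic_cube_def fun_eq_iff s_def)
qed

lemma dyadic_cube_cong:
  "dyadic_index Q m y = dyadic_index Q m x \<Longrightarrow> dyadic_cube Q m y = dyadic_cube Q m x"
  by (simp add: dyadic_cube_def)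

text \<open>Passing from generation m to generation j divides the integer index by 2^(m - j) and
  rounds down, so the finer index determines the coarser one.\<close>

lemma dyadic_index_coarser:
  assumes "dyadic_index Q m y = dyadic_index Q m x" "j \<le> m"
  shows "dyadic_index Q j y = dyadic_index Q j x"
proof
  fix i
  obtain k where m: "m = j + k"
    using assms(2) le_Suc_ex by blast
  have *: "dyadic_index Q j z i = dyadic_index Q m z i div 2 ^ k" for z
  proof -
    define t where "t = (z $ i - fst Q $ i) / snd Q"
    have "t * 2 ^ j = t * 2 ^ m / of_int (2 ^ k)"
      by (simp add: m power_add)
    then have "\<lfloor>t * 2 ^ j\<rfloor> = \<lfloor>t * 2 ^ m / of_int (2 ^ k)\<rfloor>"
      by (rule arg_cong)
    also have "\<dots> = \<lfloor>t * 2 ^ m\<rfloor> div 2 ^ k"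
      by (rule floor_divide_real_eq_div) simp
    finally show ?thesis
      by (simp only: dyadic_index_def t_def)
  qed
  show "dyadic_index Q j y i = dyadic_index Q j x i"
    using assms(1) by (simp only: *)
qed

lemma mem_dyadic_cube_self: "is_cube Q \<Longrightarrow> x \<in> cube_set (dyadic_cube Q m x)"
  by (simp add: mem_dyadic_cube)

lemma dyadic_cube_mono:
  assumes "is_cube Q" "j \<le> m"
  shows "cube_set (dyadic_cube Q m x) \<subseteq> cube_set (dyadic_cube Q j x)"
proof
  fix y
  assume "y \<in> cube_set (dyadic_cube Q m x)"
  then have "dyadic_index Q m y = dyadic_index Q m x"
    by (simp only: mem_dyadic_cube[OF assms(1)])
  then have "dyadic_index Q j y = dyadic_index Q j x"
    using assms(2) by (rule dyadic_index_coarser)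
  then show "y \<in> cube_set (dyadic_cube Q j x)"
    by (simp only: mem_dyadic_cube[OF assms(1)])
qed

lemma dyadic_cube_0:
  assumes "is_cube Q" "x \<in> cube_set Q"
  shows "dyadic_cube Q 0 x = Q"
proof -
  have Q: "snd Q > 0"
    using assms by (simp add: is_cube_def)
  have "dyadic_index Q 0 x i = 0" for i
  proof -
    have "fst Q $ i \<le> x $ i" "x $ i < fst Q $ i + snd Q"
      using assms(2) unfolding mem_cube_set by blast+
    then show ?thesis
      using Q unfolding dyadic_index_def floor_eq_iff by simp
  qed
  then show ?thesis
    by (simp add: dyadic_cube_def prod_eq_iff vec_eq_iff)
qed

text \<open>Every dyadic cube has nonempty interior, so it contains a point of a countable dense set
  and is addressed by that point.\<close>

lemma countable_dyadic_cubes: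
  fixes Q :: "'n::finite cube"
  assumes "is_cube Q"
  shows "countable (range (\<lambda>(m, x). dyadic_cube Q m x))"
proof -
  obtain X :: "(real^'n) set" where X: "countable X"
      "\<And>U. open U \<Longrightarrow> U \<noteq> {} \<Longrightarrow> \<exists>x\<in>X. x \<in> U"
    using countable_dense_setE by blast
  have "range (\<lambda>(m, x). dyadic_cube Q m x) \<subseteq> (\<lambda>(m, x). dyadic_cube Q m x) ` (UNIV \<times> X)"
  proof (rule image_subsetI, clarify)
    fix m and x :: "real^'n"
    let ?D = "dyadic_cube Q m x"
    have "box (fst ?D) (\<chi> i. fst ?D $ i + snd ?D) \<noteq> {}"
      using assms by (simp add: interval_ne_empty_cart is_cube_def)
    then obtain y where y: "y \<in> X" "y \<in> cube_set ?D"
      using X(2)[OF open_box] cube_set_between(1) by blast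
    from y(2) have "dyadic_cube Q m y = dyadic_cube Q m x"
      using assms by (intro dyadic_cube_cong) (simp add: mem_dyadic_cube)
    then show "dyadic_cube Q m x \<in> (\<lambda>(m, x). dyadic_cube Q m x) ` (UNIV \<times> X)"
      using y(1) by (auto intro!: image_eqI[where x = "(m, y)"])
  qed
  then show ?thesis
    using countable_subset[OF _ countable_image[OF countable_SIGMA[OF countableI_type X(1)]]] by blast
qed

subsection \<open>Local averages\<close>

text \<open>Averages turn into masses of a measure, which gives monotonicity and additivity over
  countable disjoint unions at once.\<close>

abbreviation power_measure :: "real \<Rightarrow> (real^'n::finite \<Rightarrow> real) \<Rightarrow> (real^'n) measure" where
  "power_measure p g \<equiv> density lebesgue (\<lambda>x. ennreal (\<bar>g x\<bar> powr p))"

lemma Lloc_measurable: "Lloc p g \<Longrightarrow> g \<in> borel_measurable lebesgue"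
  by (simp add: Lloc_def)

lemma avgp_nonneg [simp]: "avgp p Q g \<ge> 0"
  by (simp add: avgp_def)

lemma avgp_powr:
  fixes g :: "real^'n::finite \<Rightarrow> real"
  assumes p: "p \<ge> 1" and P: "is_cube P"
  shows "(LINT x:cube_set P|lebesgue. \<bar>g x\<bar> powr p) = avgp p P g powr p * snd P ^ CARD('n)"
proof -
  have "(LINT x:cube_set P|lebesgue. \<bar>g x\<bar> powr p) \<ge> 0"
    unfolding set_lebesgue_integral_def by (rule Bochner_Integration.integral_nonneg) simp
  moreover have "snd P > 0"
    using P by (simp add: is_cube_def)
  ultimately show ?thesis
    using p by (simp add: avgp_def powr_powr measure_cube_set[OF P])
qed

lemma emeasure_power_measure_cube:
  fixes g :: "real^'n::finite \<Rightarrow> real"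
  assumes p: "p \<ge> 1" and g: "Lloc p g" and P: "is_cube P"
  shows "emeasure (power_measure p g) (cube_set P) = ennreal (avgp p P g powr p * snd P ^ CARD('n))"
proof -
  have [measurable]: "g \<in> borel_measurable lebesgue"
    using g by (rule Lloc_measurable)
  let ?I = "LINT x:cube_set P|lebesgue. \<bar>g x\<bar> powr p"
  have int: "set_integrable lebesgue (cube_set P) (\<lambda>x. \<bar>g x\<bar> powr p)"
    using g P unfolding Lloc_def by blast
  have "emeasure (power_measure p g) (cube_set P)
      = (\<integral>\<^sup>+x. ennreal (\<bar>g x\<bar> powr p) * indicator (cube_set P) x \<partial>lebesgue)"
    by (rule emeasure_density) auto
  also have "\<dots> = (\<integral>\<^sup>+x. ennreal (indicator (cube_set P) x *\<^sub>R \<bar>g x\<bar> powr p) \<partial>lebesgue)"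
    by (intro nn_integral_cong) (auto split: split_indicator)
  also have "\<dots> = ennreal ?I"
    unfolding set_lebesgue_integral_def
    by (rule nn_integral_eq_integral) (use int in \<open>auto simp: set_integrable_def\<close>)
  also have "?I = avgp p P g powr p * snd P ^ CARD('n)"
    using p P by (rule avgp_powr)
  finally show ?thesis .
qed

text \<open>Doubling the side multiplies the volume by 2^n, and the p-th root turns this into
  2^(n/p). This is the source of the factor \<open>2 powr (CARD('n) / p0)\<close> in
  \<open>jump\<close>.\<close>

lemma avgp_le_double:
  fixes g :: "real^'n::finite \<Rightarrow> real"
  assumes p: "p \<ge> 1" and g: "Lloc p g" and P: "is_cube P"
    and sub: "cube_set P \<subseteq> cube_set P'" and l: "snd P' = 2 * snd P"
  shows "avgp p P g \<le> 2 powr (CARD('n) / p) * avgp p P' g"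
proof -
  have [measurable]: "g \<in> borel_measurable lebesgue"
    using g by (rule Lloc_measurable)
  have P': "is_cube P'"
    using P l by (simp add: is_cube_def)
  have pos: "snd P ^ CARD('n) > 0"
    using P by (simp add: is_cube_def)
  have "emeasure (power_measure p g) (cube_set P) \<le> emeasure (power_measure p g) (cube_set P')"
    by (rule emeasure_mono) (use sub in auto)
  then have "avgp p P g powr p * snd P ^ CARD('n) \<le> avgp p P' g powr p * snd P' ^ CARD('n)"
    using pos by (simp add: emeasure_power_measure_cube[OF p g] P P' l power_mult_distrib)
  then have "avgp p P g powr p \<le> 2 ^ CARD('n) * avgp p P' g powr p"
    using pos by (simp add: l power_mult_distrib mult.commute)
  then have "(avgp p P g powr p) powr (1 / p) \<le> (2 ^ CARD('n) * avgp p P' g powr p) powr (1 / p)"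
    using p by (intro powr_mono2) auto
  also have "(2 ^ CARD('n) * avgp p P' g powr p) powr (1 / p)
      = (2 powr real CARD('n)) powr (1 / p) * (avgp p P' g powr p) powr (1 / p)"
    by (simp add: powr_mult powr_realpow)
  finally show ?thesis
    using p by (simp add: powr_powr)
qed

section \<open>The maximal function over doubled dyadic cubes: weak type and differentiation\<close>

text \<open>Each coordinate of x - y is at most twice the side, and the Euclidean norm is at most
  the sum of the n coordinates. The ball is centred at x, as the Vitali covering needs, and its
  radius is comparable to the side.\<close>

lemma dyadic_ball:
  fixes Q :: "'n::finite cube"
  assumes Q: "is_cube Q"
  shows "cube_set (dil 2 (dyadic_cube Q m x)) \<subseteq> cball x (2 * real CARD('n) * (snd Q / 2 ^ m))"
proof
  fix y
  assume y: "y \<in> cube_set (dil 2 (dyadic_cube Q m x))"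
  let ?D = "dyadic_cube Q m x"
  define s where "s = snd Q / 2 ^ m"
  have s: "s > 0"
    using Q by (simp add: s_def is_cube_def)
  have x: "x \<in> cube_set ?D"
    using Q by (rule mem_dyadic_cube_self)
  have "\<bar>(x - y) $ i\<bar> \<le> 2 * s" for i
  proof -
    have "fst ?D $ i \<le> x $ i" "x $ i < fst ?D $ i + s"
      using x by (auto simp: mem_cube_set s_def)
    moreover have "fst ?D $ i - s / 2 \<le> y $ i" "y $ i < fst ?D $ i - s / 2 + 2 * s"
      using y[unfolded mem_cube_set, rule_format, of i] by (auto simp: s_def)
    ultimately show ?thesis
      using s by (simp add: abs_le_iff)
  qed
  then have "(\<Sum>i\<in>UNIV. \<bar>(x - y) $ i\<bar>) \<le> (\<Sum>i\<in>(UNIV::'n set). 2 * s)"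
    by (intro sum_mono)
  then have "norm (x - y) \<le> 2 * real CARD('n) * s"
    using norm_le_l1_cart[of "x - y"] by simp
  then show "y \<in> cball x (2 * real CARD('n) * (snd Q / 2 ^ m))"
    by (simp add: dist_norm s_def)
qed

lemma emeasure_lebesgue_cball:
  fixes x :: "'a::euclidean_space"
  assumes "r \<ge> 0"
  shows "emeasure lebesgue (cball x r) = ennreal (unit_ball_vol (DIM('a)) * r ^ DIM('a))"
  using emeasure_cball[OF assms, of x] by simp

text \<open>Countable subadditivity with the sum written as an integral over counting measure, so
  that the index set needs no enumeration. The indicator of the union is at most the sum of the
  indicators, and the two integrals are exchanged.\<close>

lemma emeasure_UN_countable_le:
  assumes I: "countable I" and A: "\<And>i. i \<in> I \<Longrightarrow> A i \<in> sets M"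
  shows "emeasure M (\<Union>i\<in>I. A i) \<le> (\<integral>\<^sup>+i. emeasure M (A i) \<partial>count_space I)"
proof -
  have U: "(\<Union>i\<in>I. A i) \<in> sets M"
    using I A by (intro sets.countable_UN') auto
  have "emeasure M (\<Union>i\<in>I. A i) = (\<integral>\<^sup>+x. indicator (\<Union>i\<in>I. A i) x \<partial>M)"
    using U by simp
  also have "\<dots> \<le> (\<integral>\<^sup>+x. (\<integral>\<^sup>+i. indicator (A i) x \<partial>count_space I) \<partial>M)"
  proof (rule nn_integral_mono)
    fix x
    show "(indicator (\<Union>i\<in>I. A i) x :: ennreal) \<le> (\<integral>\<^sup>+i. indicator (A i) x \<partial>count_space I)"
    proof (cases "x \<in> (\<Union>i\<in>I. A i)")
      case True
      then obtain i where "i \<in> I" "x \<in> A i"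
        by blast
      then show ?thesis
        using nn_integral_ge_point[of i I "\<lambda>i. indicator (A i) x"] True by simp
    qed simp
  qed
  also have "\<dots> = (\<integral>\<^sup>+i. (\<integral>\<^sup>+x. indicator (A i) x \<partial>M) \<partial>count_space I)"
    using I A by (intro nn_integral_count_space_nn_integral) auto
  also have "\<dots> = (\<integral>\<^sup>+i. emeasure M (A i) \<partial>count_space I)"
    using A by (intro nn_integral_cong) simp
  finally show ?thesis .
qed

text \<open>Doubled dyadic cubes from different generations overlap without bound, so the covering argument
  is run on balls around the points of U.\<close>

lemma weak_type_dyadic:
  fixes g :: "real^'n::finite \<Rightarrow> real"
  assumes p: "p \<ge> 1" and g: "Lloc p g" and Q: "is_cube Q" and L: "L > 0"
    and U: "U \<in> sets lebesgue" "U \<subseteq> cube_set Q"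
    and big: "\<And>x. x \<in> U \<Longrightarrow> \<exists>m. avgp p (dil 2 (dyadic_cube Q m x)) g > L"
  shows "emeasure lebesgue U \<le> ennreal (unit_ball_vol (CARD('n)) * (10 * real CARD('n)) ^ CARD('n)
           * (avgp p (dil 2 Q) g / L) powr p * snd Q ^ CARD('n))"
proof -
  let ?n = "CARD('n)"
  let ?\<nu> = "power_measure p g"
  have [measurable]: "g \<in> borel_measurable lebesgue"
    using g by (rule Lloc_measurable)
  have lQ: "snd Q > 0"
    using Q by (simp add: is_cube_def)
  obtain m where m: "\<And>x. x \<in> U \<Longrightarrow> avgp p (dil 2 (dyadic_cube Q (m x) x)) g > L"
    using big by metis
  define s where "s x = snd Q / 2 ^ m x" for x
  define r where "r x = 2 * real ?n * s x" for x
  have s: "s x > 0" for x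
    using lQ by (simp add: s_def)
  have r: "0 < r x \<and> r x \<le> 2 * real ?n * snd Q" for x
  proof -
    have "s x \<le> snd Q"
      using lQ by (simp add: s_def divide_le_eq mult_le_cancel_left1)
    then show ?thesis
      using s[of x] by (simp add: r_def)
  qed
  have "U \<subseteq> (\<Union>x\<in>U. cball x (r x))"
    using r by (force intro: less_imp_le)
  then obtain C where C: "countable C" "C \<subseteq> U"
    and disj: "pairwise (\<lambda>x y. disjnt (cball x (r x)) (cball y (r y))) C"
    and cov: "U \<subseteq> (\<Union>x\<in>C. cball x (5 * r x))"
    by (rule Vitali_covering_lemma_cballs[where a = "\<lambda>x. x" and r = r and B = "2 * real ?n * snd Q"])
      (use r in blast)
  \<comment> \<open>The fivefold ball has radius 5 n times the side 2 s of the doubled cube. So its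
    volume is the volume of that cube times the numerator of \<open>K\<close>; the divisor L^p turns
    volume into mass of \<open>power_measure\<close>.\<close>
  define K where "K = unit_ball_vol ?n * (5 * real ?n) ^ ?n / L powr p"
  have K0: "K \<ge> 0"
    by (simp add: K_def)
  \<comment> \<open>The balls may leave 2Q. Cutting them down to 2Q loses none of the doubled cube
    and keeps the total mass below that of 2Q.\<close>
  have ball: "emeasure lebesgue (cball x (5 * r x))
      \<le> ennreal K * emeasure ?\<nu> (cball x (r x) \<inter> cube_set (dil 2 Q))" if "x \<in> C" for x
  proof -
    let ?D = "dyadic_cube Q (m x) x"
    have x: "x \<in> U" "x \<in> cube_set Q"
      using that C(2) U(2) by auto
    have sub: "cube_set (dil 2 ?D) \<subseteq> cball x (r x) \<inter> cube_set (dil 2 Q)"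
    proof -
      have "cube_set ?D \<subseteq> cube_set Q"
        using dyadic_cube_mono[OF Q, of 0 "m x" x] dyadic_cube_0[OF Q x(2)] by simp
      then have "cube_set (dil 2 ?D) \<subseteq> cube_set (dil 2 Q)"
        by (intro dil_mono) (use Q in auto)
      then show ?thesis
        using dyadic_ball[OF Q, of "m x" x] by (simp add: r_def s_def)
    qed
    have "L powr p * (2 * s x) ^ ?n \<le> avgp p (dil 2 ?D) g powr p * (2 * s x) ^ ?n"
      using m[OF x(1)] L p s[of x] by (intro mult_right_mono powr_mono2) auto
    then have "ennreal (L powr p * (2 * s x) ^ ?n) \<le> emeasure ?\<nu> (cube_set (dil 2 ?D))"
      using emeasure_power_measure_cube[OF p g, of "dil 2 ?D"] Q
      by (simp add: s_def ennreal_leI)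
    also have "\<dots> \<le> emeasure ?\<nu> (cball x (r x) \<inter> cube_set (dil 2 Q))"
      by (rule emeasure_mono) (use sub in auto)
    finally have *: "ennreal K * ennreal (L powr p * (2 * s x) ^ ?n)
        \<le> ennreal K * emeasure ?\<nu> (cball x (r x) \<inter> cube_set (dil 2 Q))"
      by (rule mult_left_mono) simp
    have "K * (L powr p * (2 * s x) ^ ?n) = unit_ball_vol ?n * (5 * r x) ^ ?n"
    proof -
      have "5 * r x = (5 * real ?n) * (2 * s x)"
        by (simp add: r_def)
      then have "(5 * r x) ^ ?n = (5 * real ?n) ^ ?n * (2 * s x) ^ ?n"
        by (simp only: power_mult_distrib)
      then show ?thesis
        using L unfolding K_def by (simp only: times_divide_eq_left) simp
    qed
    then have "ennreal K * ennreal (L powr p * (2 * s x) ^ ?n) = emeasure lebesgue (cball x (5 * r x))"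
      using emeasure_lebesgue_cball[of "5 * r x" x] r[of x] K0
      by (simp only: ennreal_mult'[symmetric]) simp
    with * show ?thesis
      by simp
  qed
  have "emeasure lebesgue U \<le> emeasure lebesgue (\<Union>x\<in>C. cball x (5 * r x))"
    using cov C(1) by (intro emeasure_mono sets.countable_UN') auto
  also have "\<dots> \<le> (\<integral>\<^sup>+x. emeasure lebesgue (cball x (5 * r x)) \<partial>count_space C)"
    using C(1) by (intro emeasure_UN_countable_le) auto
  also have "\<dots> \<le> (\<integral>\<^sup>+x. ennreal K * emeasure ?\<nu> (cball x (r x) \<inter> cube_set (dil 2 Q)) \<partial>count_space C)"
    using ball by (intro nn_integral_mono) simp
  also have "\<dots> = ennreal K * (\<integral>\<^sup>+x. emeasure ?\<nu> (cball x (r x) \<inter> cube_set (dil 2 Q)) \<partial>count_space C)"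
    by (rule nn_integral_cmult) simp
  also have "(\<integral>\<^sup>+x. emeasure ?\<nu> (cball x (r x) \<inter> cube_set (dil 2 Q)) \<partial>count_space C)
      = emeasure ?\<nu> (\<Union>x\<in>C. cball x (r x) \<inter> cube_set (dil 2 Q))"
    using C(1) disj
    by (intro emeasure_UN_countable[symmetric])
      (auto simp: disjoint_family_on_def pairwise_def disjnt_def)
  also have "\<dots> \<le> emeasure ?\<nu> (cube_set (dil 2 Q))"
    by (rule emeasure_mono) auto
  also have "\<dots> = ennreal (avgp p (dil 2 Q) g powr p * (2 * snd Q) ^ ?n)"
    using emeasure_power_measure_cube[OF p g, of "dil 2 Q"] Q by simp
  also have "ennreal K * \<dots> = ennreal (K * (avgp p (dil 2 Q) g powr p * (2 * snd Q) ^ ?n))"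
    using K0 by (simp add: ennreal_mult')
  also have "K * (avgp p (dil 2 Q) g powr p * (2 * snd Q) ^ ?n)
      = unit_ball_vol ?n * (10 * real ?n) ^ ?n * (avgp p (dil 2 Q) g / L) powr p * snd Q ^ ?n"
  proof -
    have "10 * real ?n = (5 * real ?n) * 2"
      by simp
    then have "(10 * real ?n) ^ ?n = (5 * real ?n) ^ ?n * 2 ^ ?n"
      by (simp only: power_mult_distrib)
    moreover have "(2 * snd Q) ^ ?n = 2 ^ ?n * snd Q ^ ?n"
      by (rule power_mult_distrib)
    moreover have "(avgp p (dil 2 Q) g / L) powr p = avgp p (dil 2 Q) g powr p / L powr p"
      by (rule powr_divide)
    ultimately show ?thesis
      unfolding K_def by (simp only: times_divide_eq_left times_divide_eq_right mult_ac)
  qed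
  finally show ?thesis
    by (simp add: mult_left_mono)
qed

text \<open>A dyadic cube containing x, doubled, contains a cube of half its side with lower corner x;
  this is the shape of the averages in the available differentiation theorem.\<close>

lemma dyadic_differentiation:
  fixes g :: "real^'n::finite \<Rightarrow> real"
  assumes p: "p \<ge> 1" and g: "Lloc p g" and Q: "is_cube Q" and L: "L > 0"
  shows "AE x in lebesgue. (\<forall>m. avgp p (dil 2 (dyadic_cube Q m x)) g \<le> L)
           \<longrightarrow> \<bar>g x\<bar> \<le> 4 powr (CARD('n) / p) * L"
proof -
  let ?n = "CARD('n)"
  define h where "h x = \<bar>g x\<bar> powr p" for x
  have lQ: "snd Q > 0"
    using Q by (simp add: is_cube_def)
  have intP: "set_integrable lebesgue (cube_set P) h" if "is_cube P" for P
    using g that unfolding Lloc_def h_def by blast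
  have int: "set_integrable lebesgue (cbox a b) h" for a b :: "real^'n"
  proof -
    define l where "l = norm (b - a) + 1"
    have l: "l > 0"
      by (simp add: l_def add_nonneg_pos)
    have "cbox a b \<subseteq> cube_set (a, l)"
    proof
      fix y assume y: "y \<in> cbox a b"
      have "y $ i < a $ i + l" for i
        using component_le_norm_cart[of "b - a" i] y[unfolded mem_box_cart] abs_ge_self[of "(b - a) $ i"]
        by (simp add: l_def) (smt (verit))
      then show "y \<in> cube_set (a, l)"
        using y by (simp add: mem_cube_set mem_box_cart)
    qed
    then show ?thesis
      by (intro set_integrable_subset[OF intP[of "(a, l)"]]) (use l in \<open>auto simp: is_cube_def\<close>)
  qed
  have "h integrable_on cbox a b" for a b
    using int by (rule set_lebesgue_integral_eq_integral(1))
  then obtain N where N: "negligible N"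
    and lim: "\<And>x e. x \<notin> N \<Longrightarrow> 0 < e \<Longrightarrow> \<exists>d>0. \<forall>t. 0 < t \<and> t < d \<longrightarrow>
        norm (integral (cbox x (x + t *\<^sub>R One)) h /\<^sub>R t ^ DIM(real^'n) - h x) < e"
    by (rule integrable_ccontinuous_explicit) blast
  have key: "h x \<le> 4 ^ ?n * L powr p"
    if x: "x \<notin> N" and le: "\<forall>m. avgp p (dil 2 (dyadic_cube Q m x)) g \<le> L" for x
  proof (rule field_le_epsilon)
    fix e :: real assume "e > 0"
    then obtain d where d: "d > 0" "\<And>t. 0 < t \<Longrightarrow> t < d \<Longrightarrow>
        norm (integral (cbox x (x + t *\<^sub>R One)) h /\<^sub>R t ^ DIM(real^'n) - h x) < e"
      using lim[OF x] by meson
    have "(\<lambda>m. snd Q * (1 / 2) ^ m) \<longlonglongrightarrow> snd Q * 0"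
      by (intro tendsto_intros) auto
    then have "\<forall>\<^sub>F m in sequentially. snd Q * (1 / 2) ^ m < d"
      using d(1) by (intro order_tendstoD) auto
    then obtain m where m: "snd Q * (1 / 2) ^ m < d"
      by (auto simp: eventually_sequentially)
    \<comment> \<open>Half the side of the dyadic cube, so the doubled cube has side 4 t. The volume
      ratio 4^n becomes the factor \<open>4 powr (CARD('n) / p)\<close> of the conclusion.\<close>
    define t where "t = snd Q / 2 ^ m / 2"
    have t: "0 < t" "t < d"
    proof -
      have "snd Q / 2 ^ m < d" "snd Q / 2 ^ m > 0"
        using lQ m by (auto simp: power_one_over)
      then show "0 < t" "t < d"
        unfolding t_def by simp_all
    qed
    let ?D = "dil 2 (dyadic_cube Q m x)"
    have D: "is_cube ?D" "snd ?D = 4 * t"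
      using Q by (auto simp: t_def)
    have One: "(One :: real^'n) $ i = 1" for i
    proof -
      have "(\<Sum>b\<in>Basis. 1 *\<^sub>R b) = (One :: real^'n)"
        by (intro sum.cong) auto
      then show ?thesis
        using const_vector_cart[of 1, where 'n = 'n] by (metis vec_lambda_beta)
    qed
    have sub: "cbox x (x + t *\<^sub>R One) \<subseteq> cube_set ?D"
    proof
      fix y assume y: "y \<in> cbox x (x + t *\<^sub>R One)"
      have "fst ?D $ i \<le> y $ i \<and> y $ i < fst ?D $ i + snd ?D" for i
      proof -
        have "(x + t *\<^sub>R One) $ i = x $ i + t"
          by (simp only: vector_add_component vector_scaleR_component One real_scaleR_def mult_1_right)
        then have "x $ i \<le> y $ i" "y $ i \<le> x $ i + t"
          using y unfolding mem_box_cart by metis+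
        moreover have "fst (dyadic_cube Q m x) $ i \<le> x $ i"
          "x $ i < fst (dyadic_cube Q m x) $ i + 2 * t"
          using mem_dyadic_cube_self[OF Q, of x m, unfolded mem_cube_set, rule_format, of i]
          by (simp_all add: t_def)
        moreover have "fst ?D $ i = fst (dyadic_cube Q m x) $ i - t" "snd ?D = 4 * t"
          by (simp_all add: t_def)
        ultimately show ?thesis
          using t(1) by linarith
      qed
      then show "y \<in> cube_set ?D"
        by (simp add: mem_cube_set)
    qed
    have "integral (cbox x (x + t *\<^sub>R One)) h = (LINT y:cbox x (x + t *\<^sub>R One)|lebesgue. h y)"
      using set_lebesgue_integral_eq_integral(2)[OF int] by simp
    also have "\<dots> \<le> (LINT y:cube_set ?D|lebesgue. h y)"
      unfolding set_lebesgue_integral_def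
      using int intP[OF D(1)] sub
      by (intro integral_mono) (auto simp: set_integrable_def h_def split: split_indicator)
    also have "\<dots> = avgp p ?D g powr p * (4 * t) ^ ?n"
      using avgp_powr[OF p D(1), of g] by (simp only: h_def D(2))
    also have "\<dots> \<le> L powr p * (4 * t) ^ ?n"
      using le p t by (intro mult_right_mono powr_mono2) auto
    finally have "integral (cbox x (x + t *\<^sub>R One)) h / t ^ ?n \<le> 4 ^ ?n * L powr p"
      using t by (simp add: pos_divide_le_eq power_mult_distrib mult_ac)
    moreover have "h x - integral (cbox x (x + t *\<^sub>R One)) h / t ^ ?n < e"
      using d(2)[OF t] by (simp add: divide_inverse mult.commute)
    ultimately show "h x \<le> 4 ^ ?n * L powr p + e"
      by linarith
  qed
  have "\<bar>g x\<bar> \<le> 4 powr (?n / p) * L"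
    if "x \<notin> N" "\<forall>m. avgp p (dil 2 (dyadic_cube Q m x)) g \<le> L" for x
  proof -
    have "(\<bar>g x\<bar> powr p) powr (1 / p) \<le> (4 ^ ?n * L powr p) powr (1 / p)"
      using key[OF that] p unfolding h_def by (intro powr_mono2) auto
    also have "(4 ^ ?n * L powr p) powr (1 / p) = (4 powr real ?n) powr (1 / p) * (L powr p) powr (1 / p)"
      by (simp add: powr_mult powr_realpow)
    finally show ?thesis
      using p L by (simp add: powr_powr)
  qed
  moreover have "AE x in lebesgue. x \<notin> N"
    using N by (simp add: negligible_iff_null_sets AE_not_in)
  ultimately show ?thesis
    by (auto elim: eventually_mono)
qed

lemma dil_mono_factor:
  fixes Q :: "'n::finite cube"
  assumes Q: "is_cube Q" and s: "s > 0" and st: "s \<le> t"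
  shows "cube_set (dil s Q) \<subseteq> cube_set (dil t Q)"
proof (subst cube_set_subset_iff)
  show "is_cube (dil s Q)"
    using Q s by simp
  have "s * snd Q \<le> t * snd Q"
    using Q st by (simp add: is_cube_def)
  then show "\<forall>i. fst (dil t Q) $ i \<le> fst (dil s Q) $ i \<and>
      fst (dil s Q) $ i + snd (dil s Q) \<le> fst (dil t Q) $ i + snd (dil t Q)"
    by (simp add: field_simps)
qed

section \<open>Calderon-Zygmund selection of maximal dyadic cubes\<close>

text \<open>Each point is assigned the first generation at which P holds. Whether generation m is
  that one for a point depends only on its dyadic cube of generation m. Hence two selected cubes
  with a common point have the same generation and coincide. As P fails for Q, the selected
  generation is at least 1, and P fails for all proper ancestors within Q.\<close>

lemma stopping_cubes:
  fixes Q :: "'n::finite cube" and P :: "'n cube \<Rightarrow> bool"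
  assumes Q: "is_cube Q" and nP: "\<not> P Q"
  obtains D where "countable D" "disjoint_family_on cube_set D"
    and "(\<Union>R\<in>D. cube_set R) = {x \<in> cube_set Q. \<exists>m. P (dyadic_cube Q m x)}"
    and "\<And>R. R \<in> D \<Longrightarrow> \<exists>m x. m \<ge> 1 \<and> x \<in> cube_set Q \<and> R = dyadic_cube Q m x \<and>
           (\<forall>j<m. \<not> P (dyadic_cube Q j x))"
proof
  define stop where "stop m x \<longleftrightarrow> x \<in> cube_set Q \<and> P (dyadic_cube Q m x) \<and>
     (\<forall>j<m. \<not> P (dyadic_cube Q j x))" for m x
  define D where "D = {dyadic_cube Q m x | m x. stop m x}"
  have same: "dyadic_cube Q j y = dyadic_cube Q j x"
    if "y \<in> cube_set (dyadic_cube Q m x)" "j \<le> m" for y x j m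
  proof -
    have "dyadic_index Q m y = dyadic_index Q m x"
      using that(1) Q by (simp only: mem_dyadic_cube)
    then have "dyadic_index Q j y = dyadic_index Q j x"
      using that(2) by (rule dyadic_index_coarser)
    then show ?thesis
      by (rule dyadic_cube_cong)
  qed
  have inQ: "y \<in> cube_set Q" if "y \<in> cube_set (dyadic_cube Q m x)" "x \<in> cube_set Q" for y x m
    using that dyadic_cube_mono[OF Q, of 0 m x] dyadic_cube_0[OF Q that(2)] by auto
  have stop: "stop m y" if "stop m x" "y \<in> cube_set (dyadic_cube Q m x)" for m x y
    using that same[OF that(2)] inQ[OF that(2)] unfolding stop_def by (metis less_imp_le order_refl)
  have uniq: "m = m'" if "stop m x" "stop m' x" for m m' x
    using that unfolding stop_def by (metis linorder_neqE_nat)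
  show "countable D"
  proof (rule countable_subset[OF _ countable_dyadic_cubes[OF Q]])
    show "D \<subseteq> range (\<lambda>(m, x). dyadic_cube Q m x)"
      unfolding D_def by (smt (verit) mem_Collect_eq rangeI split_conv subsetI)
  qed
  show "disjoint_family_on cube_set D"
    unfolding disjoint_family_on_def
  proof (intro ballI impI, rule ccontr)
    fix R R'
    assume "R \<in> D" "R' \<in> D" "R \<noteq> R'" and ne: "cube_set R \<inter> cube_set R' \<noteq> {}"
    then obtain m x m' x' where R: "R = dyadic_cube Q m x" "stop m x"
      and R': "R' = dyadic_cube Q m' x'" "stop m' x'"
      unfolding D_def by blast
    obtain z where z: "z \<in> cube_set R" "z \<in> cube_set R'"
      using ne by blast
    have "m = m'"
      using stop[OF R(2)] stop[OF R'(2)] z uniq unfolding R(1) R'(1) by blast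
    moreover have "dyadic_cube Q m z = R" "dyadic_cube Q m' z = R'"
      using same z unfolding R(1) R'(1) by blast+
    ultimately show False
      using \<open>R \<noteq> R'\<close> by simp
  qed
  show "(\<Union>R\<in>D. cube_set R) = {x \<in> cube_set Q. \<exists>m. P (dyadic_cube Q m x)}"
  proof (intro set_eqI iffI)
    fix z assume "z \<in> (\<Union>R\<in>D. cube_set R)"
    then obtain m x where "stop m x" "z \<in> cube_set (dyadic_cube Q m x)"
      by (auto simp: D_def)
    then have "stop m z"
      by (rule stop)
    then show "z \<in> {x \<in> cube_set Q. \<exists>m. P (dyadic_cube Q m x)}"
      by (auto simp: stop_def)
  next
    fix z assume z: "z \<in> {x \<in> cube_set Q. \<exists>m. P (dyadic_cube Q m x)}"
    then have "stop (LEAST m. P (dyadic_cube Q m z)) z"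
      unfolding stop_def by (auto intro: LeastI dest: not_less_Least)
    then show "z \<in> (\<Union>R\<in>D. cube_set R)"
      using mem_dyadic_cube_self[OF Q, of z] unfolding D_def by blast
  qed
  fix R assume "R \<in> D"
  then obtain m x where "R = dyadic_cube Q m x" "stop m x"
    unfolding D_def by blast
  moreover from this(2) have "m \<noteq> 0"
    using nP dyadic_cube_0[OF Q, of x] unfolding stop_def by metis
  ultimately show "\<exists>m x. m \<ge> 1 \<and> x \<in> cube_set Q \<and> R = dyadic_cube Q m x \<and>
           (\<forall>j<m. \<not> P (dyadic_cube Q j x))"
    unfolding stop_def by (intro exI[of _ m] exI[of _ x]) auto
qed

lemma suminf_shift_le_ennreal:
  fixes F :: "nat \<Rightarrow> ennreal"
  shows "(\<Sum>k. F (k + m)) \<le> (\<Sum>k. F k)"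
  using suminf_offset[OF summableI, of F m] by simp

text \<open>The off-diagonal estimates act on truncated functions; this keeps the truncations in the
  domain where the operators are additive.\<close>

lemma Lloc_indicator:
  fixes g :: "real^'n::finite \<Rightarrow> real"
  assumes g: "Lloc p g" and A: "A \<in> sets lebesgue"
  shows "Lloc p (\<lambda>y. indicator A y * g y)"
  unfolding Lloc_def
proof (intro conjI allI impI)
  show "(\<lambda>y. indicator A y * g y) \<in> borel_measurable lebesgue"
    using Lloc_measurable[OF g] A by (intro borel_measurable_times borel_measurable_indicator)
next
  fix Q :: "'n cube" assume "is_cube Q"
  then have "integrable lebesgue (\<lambda>x. indicator (cube_set Q) x *\<^sub>R \<bar>g x\<bar> powr p)"
    using g unfolding Lloc_def set_integrable_def by blast
  then have "integrable lebesgue (\<lambda>x. indicator A x *\<^sub>R (indicator (cube_set Q) x *\<^sub>R \<bar>g x\<bar> powr p))"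
    using A by (rule integrable_mult_indicator[rotated])
  also have "(\<lambda>x. indicator A x *\<^sub>R (indicator (cube_set Q) x *\<^sub>R \<bar>g x\<bar> powr p))
      = (\<lambda>x. indicator (cube_set Q) x *\<^sub>R \<bar>indicator A x * g x\<bar> powr p)"
    by (auto simp: fun_eq_iff split: split_indicator)
  finally show "set_integrable lebesgue (cube_set Q) (\<lambda>x. \<bar>indicator A x * g x\<bar> powr p)"
    unfolding set_integrable_def .
qed

text \<open>Valued in \<open>ennreal\<close>, since the values of \<open>a\<close> on large dilates
  may grow too fast for convergence. The summation index is shifted so that the series starts with
  \<open>eta \<alpha> 1\<close>.\<close>

definition eta_sum :: "(nat \<Rightarrow> real) \<Rightarrow> ('n::finite cube \<Rightarrow> real) \<Rightarrow> 'n cube \<Rightarrow> ennreal" where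
  "eta_sum \<alpha> a Q = (\<Sum>k. ennreal (eta \<alpha> (k + 1) * a (dil (2 ^ (k + 1)) Q)))"

subsection \<open>Oscillations at different scales\<close>

locale O_ops =
  fixes p0 :: real
    and B :: "'n::finite cube \<Rightarrow> (real^'n \<Rightarrow> real) \<Rightarrow> (real^'n \<Rightarrow> real)"
    and \<alpha> \<beta> :: "nat \<Rightarrow> real"
  assumes p0: "1 \<le> p0" and O: "O_class p0 B \<alpha> \<beta>"
begin

lemma linear: "linear_Lloc_ops p0 B"
  using O unfolding O_class_def by blast

lemma Lloc_B: "is_cube Q \<Longrightarrow> Lloc p0 g \<Longrightarrow> Lloc p0 (B Q g)"
  using linear unfolding linear_Lloc_ops_def by blast

lemma commute:
  "is_cube Q \<Longrightarrow> is_cube R \<Longrightarrow> Lloc p0 g \<Longrightarrow> AE x in lebesgue. B Q (B R g) x = B R (B Q g) x"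
  using O unfolding O_class_def by blast

lemma alpha_nonneg: "k \<ge> 2 \<Longrightarrow> \<alpha> k \<ge> 0"
  using O unfolding O_class_def by blast

text \<open>The factor 2^(k n / p0) in the hypothesis is at least 1, so comparison applies. The
  series starts at 2, from where the terms are known to be nonnegative.\<close>

lemma summable_alpha: "summable (\<lambda>k. \<alpha> (k + 2))"
proof -
  have "summable (\<lambda>k. 2 powr (real k * real CARD('n) / p0) * \<alpha> k)"
    using O unfolding O_class_def by blast
  then have "summable (\<lambda>k. 2 powr (real (k + 2) * real CARD('n) / p0) * \<alpha> (k + 2))"
    by (rule summable_ignore_initial_segment)
  then show ?thesis
  proof (rule summable_comparison_test'[where N = 0])
    fix k :: nat
    have "(1::real) \<le> 2 powr (real (k + 2) * real CARD('n) / p0)"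
      using p0 by (intro ge_one_powr_ge_zero) auto
    then show "norm (\<alpha> (k + 2)) \<le> 2 powr (real (k + 2) * real CARD('n) / p0) * \<alpha> (k + 2)"
      using alpha_nonneg[of "k + 2"] by (simp add: mult_le_cancel_right1)
  qed
qed

text \<open>Split g at 4P. The near part gives the term with \<alpha> 2, and the far part, with j =
  1, gives the terms from \<alpha> 3 on; the two estimates join into one series valid on 2P.\<close>

lemma off_diagonal:
  assumes P: "is_cube P" and g: "Lloc p0 g"
  shows "AE x in lebesgue. x \<in> cube_set (dil 2 P) \<longrightarrow>
    ennreal \<bar>g x - B P g x\<bar> \<le> (\<Sum>k. ennreal (\<alpha> (k + 2) * avgp p0 (dil (2 ^ (k + 2)) P) g))"
proof -
  let ?A = "cube_set (dil 4 P)"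
  define g1 where "g1 y = indicator ?A y * g y" for y
  define g2 where "g2 y = indicator (- ?A) y * g y" for y
  define F where "F k = ennreal (\<alpha> (k + 2) * avgp p0 (dil (2 ^ (k + 2)) P) g)" for k
  have L: "Lloc p0 g1" "Lloc p0 g2"
    unfolding g1_def g2_def by (intro Lloc_indicator[OF g]; simp add: Compl_in_sets_lebesgue)+
  have sum: "(\<lambda>y. g1 y + g2 y) = g"
    by (auto simp: g1_def g2_def fun_eq_iff split: split_indicator)
  have near: "AE x in lebesgue. x \<in> cube_set (dil 2 P) \<longrightarrow>
      \<bar>g1 x - B P g1 x\<bar> \<le> \<alpha> 2 * avgp p0 (dil 4 P) g"
    using O P g unfolding O_class_def g1_def by blast
  have "\<forall>j\<ge>1. AE x in lebesgue. x \<in> cube_set (dil (2 ^ j) P) \<longrightarrow>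
           ennreal \<bar>indicator (- cube_set (dil (2 ^ (j + 1)) P)) x * g x
              - B P (\<lambda>y. indicator (- cube_set (dil (2 ^ (j + 1)) P)) y * g y) x\<bar>
           \<le> (\<Sum>k. ennreal (\<alpha> (k + 2 + j) * avgp p0 (dil (2 ^ (k + 2 + j)) P) g))"
    using O P g unfolding O_class_def by blast
  from this[rule_format, of 1]
  have far: "AE x in lebesgue. x \<in> cube_set (dil 2 P) \<longrightarrow>
      ennreal \<bar>g2 x - B P g2 x\<bar> \<le> (\<Sum>k. F (Suc k))"
    by (simp add: F_def g2_def[abs_def])
  have F0: "F 0 = ennreal (\<alpha> 2 * avgp p0 (dil 4 P) g)"
    by (simp add: F_def numeral_2_eq_2)
  have add: "AE x in lebesgue. B P (\<lambda>y. g1 y + g2 y) x = B P g1 x + B P g2 x"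
    using linear P L unfolding linear_Lloc_ops_def by blast
  have split: "(\<Sum>k. F k) = F 0 + (\<Sum>k. F (Suc k))"
    using suminf_offset[OF summableI, of F 1] by (simp add: add.commute)
  show ?thesis
    using near far add
  proof eventually_elim
    case (elim x)
    show ?case
    proof
      assume x: "x \<in> cube_set (dil 2 P)"
      have "g x - B P g x = (g1 x - B P g1 x) + (g2 x - B P g2 x)"
        using elim(3) fun_cong[OF sum, of x] by (simp add: sum)
      then have "ennreal \<bar>g x - B P g x\<bar> \<le> ennreal (\<bar>g1 x - B P g1 x\<bar> + \<bar>g2 x - B P g2 x\<bar>)"
        by (intro ennreal_leI) linarith
      also have "\<dots> = ennreal \<bar>g1 x - B P g1 x\<bar> + ennreal \<bar>g2 x - B P g2 x\<bar>"
        by simp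
      also have "\<dots> \<le> F 0 + (\<Sum>k. F (Suc k))"
        using elim(1,2) x F0 by (intro add_mono) (simp_all add: ennreal_leI)
      also have "\<dots> = (\<Sum>k. F k)"
        by (rule split[symmetric])
      finally show "ennreal \<bar>g x - B P g x\<bar>
          \<le> (\<Sum>k. ennreal (\<alpha> (k + 2) * avgp p0 (dil (2 ^ (k + 2)) P) g))"
        unfolding F_def .
    qed
  qed
qed

subsection \<open>The stopping-time decomposition\<close>

text \<open>Chosen so that \<open>level powr p0\<close> is at least twice the constant of
  \<open>weak_type_dyadic\<close>: the bad set at height \<open>level * T\<close> then has at most
  half the measure of Q. The maximum with 1 ensures that Q itself is not bad.\<close>

definition level :: real where
  "level = max 1 ((2 * (unit_ball_vol (CARD('n)) * (10 * real CARD('n)) ^ CARD('n))) powr (1 / p0))"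

text \<open>The first summand is the pointwise bound off the stopping cubes given by
  \<open>dyadic_differentiation\<close>. The second is the sum of the two oscillation constants, Ca
  from \<open>A_large_of_small\<close> and Ca plus \<open>level\<close> times the series from
  \<open>A_small_of_large\<close>.\<close>

definition jump :: "real \<Rightarrow> real" where
  "jump Ca = 4 powr (CARD('n) / p0) * level
     + 2 powr (CARD('n) / p0) * (2 * Ca + level * (\<Sum>k. \<alpha> (k + 2)))"

lemma level_ge_1: "level \<ge> 1"
  by (simp add: level_def)

lemma suminf_alpha_nonneg: "(\<Sum>k. \<alpha> (k + 2)) \<ge> 0"
  by (intro suminf_nonneg summable_alpha alpha_nonneg) simp

lemma jump_pos: "Ca \<ge> 0 \<Longrightarrow> jump Ca > 0"
  unfolding jump_def using level_ge_1 suminf_alpha_nonneg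
  by (intro add_pos_nonneg mult_pos_pos mult_nonneg_nonneg add_nonneg_nonneg) auto

end

locale O_ops_functional = O_ops p0 B \<alpha> \<beta>
  for p0 :: real
    and B :: "'n::finite cube \<Rightarrow> (real^'n \<Rightarrow> real) \<Rightarrow> (real^'n \<Rightarrow> real)"
    and \<alpha> \<beta> :: "nat \<Rightarrow> real" +
  fixes f :: "real^'n \<Rightarrow> real" and a :: "'n cube \<Rightarrow> real" and Ca :: real
  assumes f: "Lloc p0 f" and a: "D_inf_const Ca a"
    and avgp_le: "\<And>Q k. is_cube Q \<Longrightarrow> avgp p0 (dil (2 ^ k) Q) (B Q f) \<le> a (dil (2 ^ k) Q)"
begin

lemma Ca: "Ca \<ge> 1"
  using a unfolding D_inf_const_def by blast

lemma a_nonneg: "is_cube Q \<Longrightarrow> a Q \<ge> 0"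
  using a unfolding D_inf_const_def by blast

lemma a_mono: "is_cube Q \<Longrightarrow> is_cube R \<Longrightarrow> cube_set R \<subseteq> cube_set Q \<Longrightarrow> a R \<le> Ca * a Q"
  using a unfolding D_inf_const_def by blast

section \<open>Comparison of the error series with the series of eta\<close>

lemma eta_ge_alpha: "k \<ge> 2 \<Longrightarrow> \<alpha> k \<le> eta \<alpha> k"
  by (simp add: eta_def)

lemma eta_ge_alpha_shift: "k \<ge> 5 \<Longrightarrow> \<alpha> (k - 3) \<le> eta \<alpha> k"
  by (simp add: eta_def)

lemma eta_nonneg: "k \<ge> 1 \<Longrightarrow> eta \<alpha> k \<ge> 0"
  using eta_ge_alpha[of k] alpha_nonneg[of k] by (cases "k = 1") (auto simp: eta_def)

text \<open>The first term of the series, with coefficient 1. It controls the average of B_Q f over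
  2Q, so that the stopping time does not stop at Q.\<close>

lemma a_double_le_eta_sum:
  assumes "is_cube Q"
  shows "ennreal (a (dil 2 Q)) \<le> eta_sum \<alpha> a Q"
proof -
  have "(\<Sum>k\<in>{0}. ennreal (eta \<alpha> (k + 1) * a (dil (2 ^ (k + 1)) Q))) \<le> eta_sum \<alpha> a Q"
    unfolding eta_sum_def by (intro sum_le_suminf summableI) auto
  then show ?thesis
    by (simp add: eta_def)
qed

lemma alpha_sum_le_eta_sum:
  assumes Q: "is_cube Q"
  shows "(\<Sum>k. ennreal (\<alpha> (k + 2) * a (dil (2 ^ (k + 2)) Q))) \<le> eta_sum \<alpha> a Q"
proof -
  let ?F = "\<lambda>k. ennreal (eta \<alpha> (k + 1) * a (dil (2 ^ (k + 1)) Q))"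
  have "(\<Sum>k. ennreal (\<alpha> (k + 2) * a (dil (2 ^ (k + 2)) Q))) \<le> (\<Sum>k. ?F (k + 1))"
  proof (intro suminf_le summableI)
    fix k
    show "ennreal (\<alpha> (k + 2) * a (dil (2 ^ (k + 2)) Q)) \<le> ?F (k + 1)"
      using eta_ge_alpha[of "k + 2"] a_nonneg[of "dil (2 ^ (k + 2)) Q"] Q
      by (auto intro!: ennreal_leI mult_right_mono simp: numeral_2_eq_2)
  qed
  also have "\<dots> \<le> (\<Sum>k. ?F k)"
    by (rule suminf_shift_le_ennreal)
  finally show ?thesis
    by (simp add: eta_sum_def)
qed

text \<open>The coefficient \<alpha> (k + 2) stands next to a dilate three scales larger, and
  \<open>eta \<alpha> (k + 5)\<close> dominates it by definition.\<close>

lemma alpha_sum_shift_le_eta_sum: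
  assumes Q: "is_cube Q"
  shows "(\<Sum>k. ennreal (\<alpha> (k + 2) * a (dil (2 ^ (k + 5)) Q))) \<le> eta_sum \<alpha> a Q"
proof -
  let ?F = "\<lambda>k. ennreal (eta \<alpha> (k + 1) * a (dil (2 ^ (k + 1)) Q))"
  have "(\<Sum>k. ennreal (\<alpha> (k + 2) * a (dil (2 ^ (k + 5)) Q))) \<le> (\<Sum>k. ?F (k + 4))"
  proof (intro suminf_le summableI)
    fix k
    have "\<alpha> (k + 2) \<le> eta \<alpha> (k + 5)"
      using eta_ge_alpha_shift[of "k + 5"] by simp
    moreover have "a (dil (2 ^ (k + 5)) Q) \<ge> 0"
      using Q by (intro a_nonneg) simp
    moreover have "k + 4 + 1 = k + 5"
      by simp
    ultimately show "ennreal (\<alpha> (k + 2) * a (dil (2 ^ (k + 5)) Q)) \<le> ?F (k + 4)"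
      by (simp only:) (intro ennreal_leI mult_right_mono)
  qed
  also have "\<dots> \<le> (\<Sum>k. ?F k)"
    by (rule suminf_shift_le_ennreal)
  finally show ?thesis
    by (simp add: eta_sum_def)
qed

lemma eta_sum_mono:
  assumes Q: "is_cube Q" and R: "is_cube R" and sub: "cube_set R \<subseteq> cube_set Q"
  shows "eta_sum \<alpha> a R \<le> ennreal Ca * eta_sum \<alpha> a Q"
proof -
  have "eta_sum \<alpha> a R \<le> (\<Sum>k. ennreal Ca * ennreal (eta \<alpha> (k + 1) * a (dil (2 ^ (k + 1)) Q)))"
    unfolding eta_sum_def
  proof (intro suminf_le summableI)
    fix k
    have "cube_set (dil (2 ^ (k + 1)) R) \<subseteq> cube_set (dil (2 ^ (k + 1)) Q)"
      using R sub by (rule dil_mono) (rule one_le_power, simp)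
    then have "a (dil (2 ^ (k + 1)) R) \<le> Ca * a (dil (2 ^ (k + 1)) Q)"
      using Q R by (intro a_mono) auto
    then have "eta \<alpha> (k + 1) * a (dil (2 ^ (k + 1)) R) \<le> Ca * (eta \<alpha> (k + 1) * a (dil (2 ^ (k + 1)) Q))"
      using mult_left_mono[OF _ eta_nonneg[of "k + 1"]]
      by (metis le_add2 mult.left_commute)
    then show "ennreal (eta \<alpha> (k + 1) * a (dil (2 ^ (k + 1)) R))
        \<le> ennreal Ca * ennreal (eta \<alpha> (k + 1) * a (dil (2 ^ (k + 1)) Q))"
      using Ca by (simp add: ennreal_leI flip: ennreal_mult')
  qed
  also have "\<dots> = ennreal Ca * eta_sum \<alpha> a Q"
    unfolding eta_sum_def by (rule ennreal_suminf_cmult)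
  finally show ?thesis .
qed

section \<open>The two oscillation bounds\<close>

text \<open>A_Q sees averages of B_R f over 2^(k+2) Q. This cube lies in the dilate of R by
  2^(k+m+3), whose side is 2^(k+3) times that of Q, and this dilate lies in 2^(k+5) Q. The first
  inclusion costs a doubling of the side and makes the hypothesis on B_R f applicable; the second
  costs Ca and produces the shifted series.\<close>

lemma A_large_of_small:
  assumes Q: "is_cube Q" and x: "x \<in> cube_set Q" and T: "eta_sum \<alpha> a Q \<le> ennreal T" "T > 0"
  shows "AE y in lebesgue. y \<in> cube_set (dil 2 Q) \<longrightarrow>
    \<bar>B (dyadic_cube Q m x) f y - B Q (B (dyadic_cube Q m x) f) y\<bar> \<le> 2 powr (CARD('n) / p0) * Ca * T"
proof -
  let ?R = "dyadic_cube Q m x"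
  let ?c = "2 powr (real CARD('n) / p0)"
  let ?g = "B ?R f"
  have lQ: "snd Q > 0"
    using Q by (simp add: is_cube_def)
  have R: "is_cube ?R"
    using Q by simp
  have RQ: "cube_set ?R \<subseteq> cube_set Q"
    using dyadic_cube_mono[OF Q, of 0 m x] dyadic_cube_0[OF Q x] by simp
  have g: "Lloc p0 ?g"
    by (intro Lloc_B R f)
  have bound: "avgp p0 (dil (2 ^ (k + 2)) Q) ?g \<le> ?c * Ca * a (dil (2 ^ (k + 5)) Q)" for k
  proof -
    have e: "(2::real) ^ (k + m + 3) * (snd Q / 2 ^ m) = 2 ^ (k + 3) * snd Q"
      by (simp add: power_add)
    \<comment> \<open>In terms of \<open>u\<close> all sides are explicit multiples, and both
      inclusions reduce to linear inequalities.\<close>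
    define u where "u = 2 ^ k * snd Q"
    have u: "snd Q \<le> u"
      using lQ mult_right_mono[of 1 "2 ^ k" "snd Q"] by (simp add: u_def)
    have pow: "2 ^ (k + 2) * snd Q = 4 * u" "2 ^ (k + 3) * snd Q = 8 * u" "2 ^ (k + 5) * snd Q = 32 * u"
      by (simp_all add: u_def power_add)
    have "avgp p0 (dil (2 ^ (k + 2)) Q) ?g \<le> ?c * avgp p0 (dil (2 ^ (k + m + 3)) ?R) ?g"
    proof (rule avgp_le_double[OF p0 g])
      show "cube_set (dil (2 ^ (k + 2)) Q) \<subseteq> cube_set (dil (2 ^ (k + m + 3)) ?R)"
      proof (rule dil_supset_dil[OF R Q RQ])
        show "2 ^ (k + 2) * snd Q + snd Q \<le> 2 ^ (k + m + 3) * snd ?R"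
          unfolding snd_dyadic_cube e pow using u lQ by linarith
      qed simp
      show "snd (dil (2 ^ (k + m + 3)) ?R) = 2 * snd (dil (2 ^ (k + 2)) Q)"
        unfolding snd_dil snd_dyadic_cube e pow by simp
    qed (use Q in simp)
    also have "\<dots> \<le> ?c * a (dil (2 ^ (k + m + 3)) ?R)"
      by (intro mult_left_mono avgp_le R) simp
    also have "\<dots> \<le> ?c * (Ca * a (dil (2 ^ (k + 5)) Q))"
    proof (intro mult_left_mono a_mono)
      show "cube_set (dil (2 ^ (k + m + 3)) ?R) \<subseteq> cube_set (dil (2 ^ (k + 5)) Q)"
      proof (rule dil_subset_dil[OF R Q RQ])
        show "2 ^ (k + m + 3) * snd ?R + snd Q \<le> 2 ^ (k + 5) * snd Q"
          unfolding snd_dyadic_cube e pow using u lQ by linarith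
      qed simp
    qed (use Q in auto)
    finally show ?thesis
      by (simp add: mult.assoc)
  qed
  have "(\<Sum>k. ennreal (\<alpha> (k + 2) * avgp p0 (dil (2 ^ (k + 2)) Q) ?g))
      \<le> (\<Sum>k. ennreal (?c * Ca) * ennreal (\<alpha> (k + 2) * a (dil (2 ^ (k + 5)) Q)))"
  proof (intro suminf_le summableI)
    fix k
    have "\<alpha> (k + 2) * avgp p0 (dil (2 ^ (k + 2)) Q) ?g \<le> ?c * Ca * (\<alpha> (k + 2) * a (dil (2 ^ (k + 5)) Q))"
      using mult_left_mono[OF bound[of k] alpha_nonneg[of "k + 2"]] by (simp add: mult.left_commute)
    then show "ennreal (\<alpha> (k + 2) * avgp p0 (dil (2 ^ (k + 2)) Q) ?g)
        \<le> ennreal (?c * Ca) * ennreal (\<alpha> (k + 2) * a (dil (2 ^ (k + 5)) Q))"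
      using Ca by (simp add: ennreal_leI flip: ennreal_mult')
  qed
  also have "\<dots> = ennreal (?c * Ca) * (\<Sum>k. ennreal (\<alpha> (k + 2) * a (dil (2 ^ (k + 5)) Q)))"
    by (rule ennreal_suminf_cmult)
  also have "\<dots> \<le> ennreal (?c * Ca) * ennreal T"
    using alpha_sum_shift_le_eta_sum[OF Q] T(1) by (intro mult_left_mono) auto
  also have "\<dots> = ennreal (?c * Ca * T)"
    using Ca by (simp add: ennreal_mult')
  finally have *: "(\<Sum>k. ennreal (\<alpha> (k + 2) * avgp p0 (dil (2 ^ (k + 2)) Q) ?g)) \<le> ennreal (?c * Ca * T)" .
  show ?thesis
    using off_diagonal[OF Q g]
  proof eventually_elim
    case (elim y)
    have "?c * Ca * T \<ge> 0"
      using Ca T by simp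
    moreover have "ennreal \<bar>B (dyadic_cube Q m x) f y - B Q (B (dyadic_cube Q m x) f) y\<bar> \<le> ennreal (?c * Ca * T)"
      if "y \<in> cube_set (dil 2 Q)"
      using elim that * by (blast intro: order_trans)
    ultimately show ?case
      by (simp only: ennreal_le_iff) blast
  qed
qed

text \<open>A_R sees averages of B_Q f over 2^(k+2) R. If this dilate is no larger than Q, it lies
  in the double of the ancestor of the same side, where the stopping rule bounds the average. If it
  is larger than Q, it lies in a dilate of Q of twice its side, where the hypothesis on B_Q f
  applies. Adding the two bounds serves all k; only the first needs the sum of the \<alpha> alone to
  converge.\<close>

lemma A_small_of_large:
  assumes Q: "is_cube Q" and x: "x \<in> cube_set Q" and T: "eta_sum \<alpha> a Q \<le> ennreal T" "T > 0"
    and m: "m \<ge> 1"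
    and good: "\<forall>j<m. avgp p0 (dil 2 (dyadic_cube Q j x)) (B Q f) \<le> level * T"
  shows "AE y in lebesgue. y \<in> cube_set (dil 2 (dyadic_cube Q m x)) \<longrightarrow>
    \<bar>B Q f y - B (dyadic_cube Q m x) (B Q f) y\<bar>
      \<le> 2 powr (CARD('n) / p0) * (Ca + level * (\<Sum>k. \<alpha> (k + 2))) * T"
proof -
  let ?R = "dyadic_cube Q m x"
  let ?c = "2 powr (real CARD('n) / p0)"
  let ?g = "B Q f"
  let ?S = "\<Sum>k. \<alpha> (k + 2)"
  have lQ: "snd Q > 0"
    using Q by (simp add: is_cube_def)
  have R: "is_cube ?R"
    using Q by simp
  have RQ: "cube_set ?R \<subseteq> cube_set Q"
    using dyadic_cube_mono[OF Q, of 0 m x] dyadic_cube_0[OF Q x] by simp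
  have g: "Lloc p0 ?g"
    by (intro Lloc_B Q f)
  have bound: "avgp p0 (dil (2 ^ (k + 2)) ?R) ?g \<le> ?c * (level * T + Ca * a (dil (2 ^ (k + 2)) Q))" for k
  proof (cases "k + 2 \<le> m")
    case True
    \<comment> \<open>The generation whose cubes have the side of 2^(k+2) R. It is smaller than m,
      so the ancestor is proper and not bad.\<close>
    define j where "j = m - (k + 2)"
    have m': "m = j + (k + 2)"
      using True by (simp add: j_def)
    let ?P = "dyadic_cube Q j x"
    have e: "2 ^ (k + 2) * (snd Q / 2 ^ m) = snd Q / 2 ^ j"
      by (simp add: m' power_add)
    have "avgp p0 (dil (2 ^ (k + 2)) ?R) ?g \<le> ?c * avgp p0 (dil 2 ?P) ?g"
    proof (rule avgp_le_double[OF p0 g])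
      show "cube_set (dil (2 ^ (k + 2)) ?R) \<subseteq> cube_set (dil 2 ?P)"
      proof (rule dil_subset_dil[OF R])
        show "cube_set ?R \<subseteq> cube_set ?P"
          using m' by (intro dyadic_cube_mono[OF Q]) simp
        show "2 ^ (k + 2) * snd ?R + snd ?P \<le> 2 * snd ?P"
          using e by simp
      qed (use Q in auto)
      show "snd (dil 2 ?P) = 2 * snd (dil (2 ^ (k + 2)) ?R)"
        using e by simp
    qed (use Q in simp)
    also have "\<dots> \<le> ?c * (level * T)"
      using good m' by (intro mult_left_mono) auto
    also have "\<dots> \<le> ?c * (level * T + Ca * a (dil (2 ^ (k + 2)) Q))"
      using Ca a_nonneg[of "dil (2 ^ (k + 2)) Q"] Q by (intro mult_left_mono) auto
    finally show ?thesis .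
  next
    case False
    define j where "j = k + 2 - m"
    have k: "k + 2 = j + m"
      using False by (simp add: j_def)
    have e: "2 ^ (k + 2) * (snd Q / 2 ^ m) = 2 ^ j * snd Q"
      by (simp only: k power_add) simp
    have "avgp p0 (dil (2 ^ (k + 2)) ?R) ?g \<le> ?c * avgp p0 (dil (2 ^ (j + 1)) Q) ?g"
    proof (rule avgp_le_double[OF p0 g])
      show "cube_set (dil (2 ^ (k + 2)) ?R) \<subseteq> cube_set (dil (2 ^ (j + 1)) Q)"
      proof (rule dil_subset_dil[OF R Q RQ])
        have "1 * snd Q \<le> 2 ^ j * snd Q"
          using lQ by (intro mult_right_mono) auto
        then show "2 ^ (k + 2) * snd ?R + snd Q \<le> 2 ^ (j + 1) * snd Q"
          unfolding snd_dyadic_cube e by (simp add: mult.commute)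
      qed simp
      show "snd (dil (2 ^ (j + 1)) Q) = 2 * snd (dil (2 ^ (k + 2)) ?R)"
        unfolding snd_dil snd_dyadic_cube e by simp
    qed (use Q in simp)
    also have "\<dots> \<le> ?c * a (dil (2 ^ (j + 1)) Q)"
      by (intro mult_left_mono avgp_le Q) simp
    also have "\<dots> \<le> ?c * (Ca * a (dil (2 ^ (k + 2)) Q))"
    proof (intro mult_left_mono a_mono)
      \<comment> \<open>As m \<ge> 1, j + 1 is at most k + 2: the scale lost in passing from R to Q
        is regained because R is a proper subcube, and no index shift arises.\<close>
      show "cube_set (dil (2 ^ (j + 1)) Q) \<subseteq> cube_set (dil (2 ^ (k + 2)) Q)"
        using k m by (intro dil_mono_factor[OF Q] power_increasing) auto
    qed (use Q in auto)
    also have "\<dots> \<le> ?c * (level * T + Ca * a (dil (2 ^ (k + 2)) Q))"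
      using level_ge_1 T(2) by (intro mult_left_mono) auto
    finally show ?thesis .
  qed
  have "(\<Sum>k. ennreal (\<alpha> (k + 2) * avgp p0 (dil (2 ^ (k + 2)) ?R) ?g))
      \<le> (\<Sum>k. ennreal (?c * (level * T)) * ennreal (\<alpha> (k + 2))
             + ennreal (?c * Ca) * ennreal (\<alpha> (k + 2) * a (dil (2 ^ (k + 2)) Q)))"
  proof (intro suminf_le summableI)
    fix k
    have nn: "\<alpha> (k + 2) \<ge> 0" "a (dil (2 ^ (k + 2)) Q) \<ge> 0"
      using alpha_nonneg a_nonneg Q by auto
    have "\<alpha> (k + 2) * avgp p0 (dil (2 ^ (k + 2)) ?R) ?g
        \<le> \<alpha> (k + 2) * (?c * (level * T + Ca * a (dil (2 ^ (k + 2)) Q)))"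
      by (intro mult_left_mono bound nn)
    also have "\<dots> = ?c * (level * T) * \<alpha> (k + 2) + ?c * Ca * (\<alpha> (k + 2) * a (dil (2 ^ (k + 2)) Q))"
      by (simp add: algebra_simps)
    finally have "ennreal (\<alpha> (k + 2) * avgp p0 (dil (2 ^ (k + 2)) ?R) ?g)
        \<le> ennreal (?c * (level * T) * \<alpha> (k + 2) + ?c * Ca * (\<alpha> (k + 2) * a (dil (2 ^ (k + 2)) Q)))"
      by (rule ennreal_leI)
    also have "\<dots> = ennreal (?c * (level * T)) * ennreal (\<alpha> (k + 2))
             + ennreal (?c * Ca) * ennreal (\<alpha> (k + 2) * a (dil (2 ^ (k + 2)) Q))"
      using Ca T(2) level_ge_1 nn by (subst ennreal_plus) (auto simp: ennreal_mult'[symmetric])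
    finally show "ennreal (\<alpha> (k + 2) * avgp p0 (dil (2 ^ (k + 2)) ?R) ?g)
        \<le> ennreal (?c * (level * T)) * ennreal (\<alpha> (k + 2))
             + ennreal (?c * Ca) * ennreal (\<alpha> (k + 2) * a (dil (2 ^ (k + 2)) Q))" .
  qed
  also have "\<dots> = ennreal (?c * (level * T)) * (\<Sum>k. ennreal (\<alpha> (k + 2)))
             + ennreal (?c * Ca) * (\<Sum>k. ennreal (\<alpha> (k + 2) * a (dil (2 ^ (k + 2)) Q)))"
    by (subst suminf_add[symmetric]) (auto intro: summableI simp: ennreal_suminf_cmult)
  also have "(\<Sum>k. ennreal (\<alpha> (k + 2))) = ennreal ?S"
    by (intro suminf_ennreal2 summable_alpha alpha_nonneg) simp
  also have "ennreal (?c * (level * T)) * ennreal ?S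
        + ennreal (?c * Ca) * (\<Sum>k. ennreal (\<alpha> (k + 2) * a (dil (2 ^ (k + 2)) Q)))
      \<le> ennreal (?c * (level * T)) * ennreal ?S + ennreal (?c * Ca) * ennreal T"
    using alpha_sum_le_eta_sum[OF Q] T(1) by (intro add_left_mono mult_left_mono) auto
  also have "\<dots> = ennreal (?c * (level * T) * ?S + ?c * Ca * T)"
    using Ca T(2) level_ge_1 suminf_alpha_nonneg
    by (subst ennreal_plus) (auto simp: ennreal_mult'[symmetric])
  also have "?c * (level * T) * ?S + ?c * Ca * T = ?c * (Ca + level * ?S) * T"
    by (simp add: algebra_simps)
  finally have *: "(\<Sum>k. ennreal (\<alpha> (k + 2) * avgp p0 (dil (2 ^ (k + 2)) ?R) ?g))
      \<le> ennreal (?c * (Ca + level * ?S) * T)" .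
  show ?thesis
    using off_diagonal[OF R g]
  proof eventually_elim
    case (elim y)
    have "?c * (Ca + level * ?S) * T \<ge> 0"
      using Ca T level_ge_1 suminf_alpha_nonneg by simp
    moreover have "ennreal \<bar>B Q f y - B ?R (B Q f) y\<bar> \<le> ennreal (?c * (Ca + level * ?S) * T)"
      if "y \<in> cube_set (dil 2 ?R)"
      using elim that * by (blast intro: order_trans)
    ultimately show ?case
      by (simp only: ennreal_le_iff) blast
  qed
qed

lemma stopping_decomposition:
  assumes Q: "is_cube Q" and T: "eta_sum \<alpha> a Q \<le> ennreal T" "T > 0"
  obtains D where "countable D" "disjoint_family_on cube_set D"
    and "\<And>R. R \<in> D \<Longrightarrow> is_cube R \<and> cube_set R \<subseteq> cube_set Q"
    and "2 * emeasure lebesgue (\<Union>R\<in>D. cube_set R) \<le> emeasure lebesgue (cube_set Q)"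
    and "AE y in lebesgue. y \<in> cube_set Q - (\<Union>R\<in>D. cube_set R) \<longrightarrow> \<bar>B Q f y\<bar> \<le> jump Ca * T"
    and "\<And>R. R \<in> D \<Longrightarrow>
      AE y in lebesgue. y \<in> cube_set R \<longrightarrow> \<bar>B Q f y\<bar> \<le> \<bar>B R f y\<bar> + jump Ca * T"
proof -
  let ?c = "2 powr (real CARD('n) / p0)"
  let ?S = "\<Sum>k. \<alpha> (k + 2)"
  let ?g = "B Q f"
  have g: "Lloc p0 ?g"
    by (intro Lloc_B Q f)
  have lQ: "snd Q > 0"
    using Q by (simp add: is_cube_def)
  have LT: "level * T > 0"
    using level_ge_1 T(2) by simp
  define bad where "bad R \<longleftrightarrow> avgp p0 (dil 2 R) ?g > level * T" for R
  have "ennreal (a (dil 2 Q)) \<le> ennreal T"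
    using a_double_le_eta_sum[OF Q] T(1) by (rule order_trans)
  then have "a (dil 2 Q) \<le> T"
    using T(2) by (simp add: ennreal_le_iff)
  then have top: "avgp p0 (dil 2 Q) ?g \<le> T"
    using avgp_le[OF Q, of 1] by simp
  also have "T \<le> level * T"
    using level_ge_1 T(2) by simp
  finally have "\<not> bad Q"
    by (simp add: bad_def)
  with Q obtain D where D: "countable D" "disjoint_family_on cube_set D"
    and U: "(\<Union>R\<in>D. cube_set R) = {x \<in> cube_set Q. \<exists>m. bad (dyadic_cube Q m x)}"
    and stop: "\<And>R. R \<in> D \<Longrightarrow> \<exists>m x. m \<ge> 1 \<and> x \<in> cube_set Q \<and> R = dyadic_cube Q m x \<and>
           (\<forall>j<m. \<not> bad (dyadic_cube Q j x))"
    by (rule stopping_cubes) blast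
  let ?U = "\<Union>R\<in>D. cube_set R"
  have cube: "is_cube R \<and> cube_set R \<subseteq> cube_set Q" if "R \<in> D" for R
    using stop[OF that] Q U that by auto
  have small: "2 * emeasure lebesgue ?U \<le> emeasure lebesgue (cube_set Q)"
  proof -
    define V where "V = unit_ball_vol (CARD('n)) * (10 * real CARD('n)) ^ CARD('n)"
    have V: "V \<ge> 0"
      by (simp add: V_def)
    have "emeasure lebesgue ?U \<le> ennreal (V * (avgp p0 (dil 2 Q) ?g / (level * T)) powr p0 * snd Q ^ CARD('n))"
      unfolding V_def
    proof (rule weak_type_dyadic[OF p0 g Q LT])
      show "?U \<in> sets lebesgue"
        using D(1) by (intro sets.countable_UN') auto
    qed (auto simp: U bad_def)
    also have "\<dots> \<le> ennreal (1 / 2 * snd Q ^ CARD('n))"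
    proof (intro ennreal_leI mult_right_mono)
      have "avgp p0 (dil 2 Q) ?g / (level * T) \<le> 1 / level"
        using top T(2) level_ge_1 by (simp add: field_simps)
      then have "(avgp p0 (dil 2 Q) ?g / (level * T)) powr p0 \<le> (1 / level) powr p0"
        using p0 LT by (intro powr_mono2) auto
      also have "\<dots> = 1 / level powr p0"
        by (simp add: powr_divide)
      finally have "V * (avgp p0 (dil 2 Q) ?g / (level * T)) powr p0 \<le> V * (1 / level powr p0)"
        using V by (rule mult_left_mono)
      \<comment> \<open>\<open>V\<close> is the constant of the weak type estimate;
        \<open>level\<close> was defined to make this hold.\<close>
      moreover have "2 * V \<le> level powr p0"
      proof -
        have "2 * V = ((2 * V) powr (1 / p0)) powr p0"
          using p0 V by (simp add: powr_powr)
        also have "\<dots> \<le> level powr p0"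
          using p0 by (intro powr_mono2) (auto simp: level_def V_def)
        finally show ?thesis .
      qed
      moreover have "level powr p0 > 0"
        using level_ge_1 by simp
      then have "V * (1 / level powr p0) \<le> 1 / 2"
        using \<open>2 * V \<le> level powr p0\<close> by (simp add: pos_divide_le_eq)
      ultimately show "V * (avgp p0 (dil 2 Q) ?g / (level * T)) powr p0 \<le> 1 / 2"
        by linarith
    qed (use lQ in simp)
    finally have "2 * emeasure lebesgue ?U \<le> 2 * ennreal (1 / 2 * snd Q ^ CARD('n))"
      by (rule mult_left_mono) simp
    also have "\<dots> = ennreal (snd Q ^ CARD('n))"
      using lQ by (simp add: ennreal_mult'[of 2, symmetric, simplified])
    finally show ?thesis
      by (simp only: emeasure_cube_set[OF Q])
  qed
  have jump1: "4 powr (real CARD('n) / p0) * (level * T) \<le> jump Ca * T"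
    and jump2: "?c * Ca * T + ?c * (Ca + level * ?S) * T \<le> jump Ca * T"
  proof -
    define x1 where "x1 = 4 powr (real CARD('n) / p0) * level"
    define x2 where "x2 = ?c * (2 * Ca + level * ?S)"
    have x: "x1 \<ge> 0" "x2 \<ge> 0"
      using Ca level_ge_1 suminf_alpha_nonneg by (auto simp: x1_def x2_def)
    have j: "jump Ca * T = x1 * T + x2 * T"
      by (simp add: jump_def x1_def x2_def distrib_right)
    have "4 powr (real CARD('n) / p0) * (level * T) = x1 * T"
      "?c * Ca * T + ?c * (Ca + level * ?S) * T = x2 * T"
      by (simp_all add: x1_def x2_def algebra_simps)
    moreover have "x1 * T \<ge> 0" "x2 * T \<ge> 0"
      using x T(2) by auto
    ultimately show "4 powr (real CARD('n) / p0) * (level * T) \<le> jump Ca * T"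
      "?c * Ca * T + ?c * (Ca + level * ?S) * T \<le> jump Ca * T"
      using j by linarith+
  qed
  show ?thesis
  proof (rule that[OF D cube small])
    show "AE y in lebesgue. y \<in> cube_set Q - ?U \<longrightarrow> \<bar>?g y\<bar> \<le> jump Ca * T"
      using dyadic_differentiation[OF p0 g Q LT]
    proof eventually_elim
      case (elim y)
      show ?case
      proof
        assume "y \<in> cube_set Q - ?U"
        then have "\<forall>m. avgp p0 (dil 2 (dyadic_cube Q m y)) ?g \<le> level * T"
          unfolding U by (auto simp: bad_def not_less)
        then show "\<bar>?g y\<bar> \<le> jump Ca * T"
          using elim jump1 by (meson order_trans)
      qed
    qed
  next
    fix R assume "R \<in> D"
    then obtain m x where m: "m \<ge> 1" and x: "x \<in> cube_set Q" and R: "R = dyadic_cube Q m x"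
      and good: "\<forall>j<m. avgp p0 (dil 2 (dyadic_cube Q j x)) ?g \<le> level * T"
      using stop[OF \<open>R \<in> D\<close>] by (auto simp: bad_def not_less)
    have cR: "is_cube R"
      using cube \<open>R \<in> D\<close> by blast
    have subR: "cube_set R \<subseteq> cube_set (dil 2 R)"
      using dil_mono_factor[OF cR, of 1 2] by (simp add: dil_def)
    have subQ: "cube_set R \<subseteq> cube_set (dil 2 Q)"
      using cube[OF \<open>R \<in> D\<close>] dil_mono_factor[OF Q, of 1 2] by (auto simp: dil_def)
    show "AE y in lebesgue. y \<in> cube_set R \<longrightarrow> \<bar>?g y\<bar> \<le> \<bar>B R f y\<bar> + jump Ca * T"
      using A_large_of_small[OF Q x T, of m, folded R] A_small_of_large[OF Q x T m good, folded R]
        commute[OF Q cR f]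
    proof eventually_elim
      case (elim y)
      show ?case
      proof
        assume "y \<in> cube_set R"
        then have "\<bar>B R f y - B Q (B R f) y\<bar> \<le> ?c * Ca * T"
          "\<bar>?g y - B R ?g y\<bar> \<le> ?c * (Ca + level * ?S) * T"
          using elim(1,2) subR subQ by blast+
        then show "\<bar>?g y\<bar> \<le> \<bar>B R f y\<bar> + jump Ca * T"
          using elim(3) jump2 by linarith
      qed
    qed
  qed
qed

end

subsection \<open>Weights\<close>

abbreviation weight_measure :: "(real^'n::finite \<Rightarrow> real) \<Rightarrow> (real^'n) measure" where
  "weight_measure w \<equiv> density lebesgue (\<lambda>x. ennreal (w x))"

text \<open>The A_infinity condition at the single proportion one half, which is the proportion that
  the stopping cubes can fill. That \<theta> is below 1 is required separately.\<close>

definition halving :: "real \<Rightarrow> (real^'n::finite \<Rightarrow> real) \<Rightarrow> bool" where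
  "halving \<theta> w \<longleftrightarrow> (\<forall>Q E. is_cube Q \<longrightarrow> E \<in> sets lebesgue \<longrightarrow> E \<subseteq> cube_set Q \<longrightarrow>
     2 * emeasure lebesgue E \<le> emeasure lebesgue (cube_set Q) \<longrightarrow>
     emeasure (weight_measure w) E \<le> ennreal \<theta> * emeasure (weight_measure w) (cube_set Q))"

lemma halvingD:
  "halving \<theta> w \<Longrightarrow> is_cube Q \<Longrightarrow> E \<in> sets lebesgue \<Longrightarrow> E \<subseteq> cube_set Q \<Longrightarrow>
   2 * emeasure lebesgue E \<le> emeasure lebesgue (cube_set Q) \<Longrightarrow>
   emeasure (weight_measure w) E \<le> ennreal \<theta> * emeasure (weight_measure w) (cube_set Q)"
  unfolding halving_def by blast

lemma weight_measurable: "weight w \<Longrightarrow> w \<in> borel_measurable lebesgue"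
  by (simp add: weight_def)

lemma emeasure_weight_cube:
  fixes w :: "real^'n::finite \<Rightarrow> real"
  assumes w: "weight w" and Q: "is_cube Q"
  shows "emeasure (weight_measure w) (cube_set Q) = ennreal (avg Q w * snd Q ^ CARD('n))"
    and "avg Q w \<ge> 0"
proof -
  have [measurable]: "w \<in> borel_measurable lebesgue"
    using w by (rule weight_measurable)
  have w0: "w x \<ge> 0" for x
    using w unfolding weight_def by blast
  have lQ: "snd Q > 0"
    using Q by (simp add: is_cube_def)
  let ?I = "LINT x:cube_set Q|lebesgue. w x"
  have int: "set_integrable lebesgue (cube_set Q) w"
    using w Q unfolding weight_def by blast
  have I0: "?I \<ge> 0"
    unfolding set_lebesgue_integral_def by (rule Bochner_Integration.integral_nonneg) (simp add: w0)
  have "emeasure (weight_measure w) (cube_set Q)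
      = (\<integral>\<^sup>+x. ennreal (w x) * indicator (cube_set Q) x \<partial>lebesgue)"
    by (rule emeasure_density) auto
  also have "\<dots> = (\<integral>\<^sup>+x. ennreal (indicator (cube_set Q) x *\<^sub>R w x) \<partial>lebesgue)"
    by (intro nn_integral_cong) (auto split: split_indicator)
  also have "\<dots> = ennreal ?I"
    unfolding set_lebesgue_integral_def
    by (rule nn_integral_eq_integral) (use int in \<open>auto simp: set_integrable_def w0\<close>)
  also have "?I = avg Q w * snd Q ^ CARD('n)"
    using lQ by (simp add: avg_def measure_cube_set[OF Q])
  finally show "emeasure (weight_measure w) (cube_set Q) = ennreal (avg Q w * snd Q ^ CARD('n))" .
  show "avg Q w \<ge> 0"
    using I0 by (simp add: avg_def)
qed

text \<open>Chebyshev's inequality. It serves both to find much weight where w is large and, for the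
  dual weight, to bound the measure of the set where that weight is large.\<close>

lemma emeasure_weight_ge:
  fixes w :: "real^'n::finite \<Rightarrow> real"
  assumes w: "weight w" and G: "G \<in> sets lebesgue" "G \<subseteq> F" "F \<in> sets lebesgue"
    and fin: "emeasure lebesgue G \<noteq> top" and v: "v \<ge> 0"
    and ge: "AE x in lebesgue. x \<in> G \<longrightarrow> v \<le> w x"
  shows "ennreal (v * measure lebesgue G) \<le> emeasure (weight_measure w) F"
proof -
  have [measurable]: "w \<in> borel_measurable lebesgue"
    using w by (rule weight_measurable)
  have "ennreal (v * measure lebesgue G) = ennreal v * emeasure lebesgue G"
    using v by (simp only: emeasure_eq_ennreal_measure[OF fin] ennreal_mult')
  also have "\<dots> = (\<integral>\<^sup>+x. ennreal v * indicator G x \<partial>lebesgue)"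
    using G(1) by (simp add: nn_integral_cmult)
  also have "\<dots> \<le> (\<integral>\<^sup>+x. ennreal (w x) * indicator F x \<partial>lebesgue)"
    using ge
    by (intro nn_integral_mono_AE, eventually_elim)
      (use G(2) in \<open>auto split: split_indicator intro: ennreal_leI\<close>)
  also have "\<dots> = emeasure (weight_measure w) F"
    by (rule emeasure_density[symmetric]) (use G in auto)
  finally show ?thesis .
qed

text \<open>Pass to complements: if E fills at most half of Q, then Q - E fills at least half and
  carries a fixed share of the weight, which E cannot have.\<close>

lemma halving_of_lower_bound:
  fixes w :: "real^'n::finite \<Rightarrow> real"
  assumes w: "weight w" and c: "c > 0"
    and low: "\<And>Q F. is_cube Q \<Longrightarrow> F \<in> sets lebesgue \<Longrightarrow> F \<subseteq> cube_set Q \<Longrightarrow>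
        measure lebesgue (cube_set Q) \<le> 2 * measure lebesgue F \<Longrightarrow>
        ennreal (c * (avg Q w * snd Q ^ CARD('n))) \<le> emeasure (weight_measure w) F"
  shows "\<exists>\<theta>\<ge>0. \<theta> < 1 \<and> halving \<theta> w"
proof (intro exI conjI)
  \<comment> \<open>The cap at 1 keeps \<theta> = 1 - d nonnegative.\<close>
  define d where "d = min c 1"
  have d: "d > 0" "d \<le> c" "d \<le> 1"
    using c by (auto simp: d_def)
  show "1 - d \<ge> 0" "1 - d < 1"
    using d by auto
  show "halving (1 - d) w"
    unfolding halving_def
  proof (intro allI impI)
    fix Q :: "'n cube" and E
    assume Q: "is_cube Q" and E: "E \<in> sets lebesgue" "E \<subseteq> cube_set Q"
      and half: "2 * emeasure lebesgue E \<le> emeasure lebesgue (cube_set Q)"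
    let ?W = "weight_measure w"
    let ?I = "avg Q w * snd Q ^ CARD('n)"
    have lQ: "snd Q > 0"
      using Q by (simp add: is_cube_def)
    have I0: "?I \<ge> 0"
      using emeasure_weight_cube(2)[OF w Q] lQ by simp
    have finQ: "emeasure lebesgue (cube_set Q) \<noteq> top"
      by (simp add: emeasure_cube_set[OF Q])
    have finE: "emeasure lebesgue E \<noteq> top"
      using emeasure_mono[OF E(2) cube_set_lebesgue] finQ by (metis top.extremum_unique)
    have "2 * measure lebesgue E \<le> measure lebesgue (cube_set Q)"
    proof -
      have "ennreal (2 * measure lebesgue E) \<le> ennreal (measure lebesgue (cube_set Q))"
        using half finE finQ
        by (simp add: emeasure_eq_ennreal_measure ennreal_mult')
      then show ?thesis
        by (simp add: ennreal_le_iff)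
    qed
    moreover have "measure lebesgue (cube_set Q - E) = measure lebesgue (cube_set Q) - measure lebesgue E"
      using finQ E by (intro measure_Diff) auto
    ultimately have "ennreal (c * ?I) \<le> emeasure ?W (cube_set Q - E)"
      using E by (intro low Q) auto
    then have "ennreal (d * ?I) \<le> emeasure ?W (cube_set Q - E)"
      using d(2) I0 by (meson ennreal_leI mult_right_mono order_trans)
    then have "emeasure ?W E + ennreal (d * ?I) \<le> emeasure ?W E + emeasure ?W (cube_set Q - E)"
      by (rule add_left_mono)
    also have "\<dots> = emeasure ?W (E \<union> (cube_set Q - E))"
      using E by (intro plus_emeasure) auto
    also have "E \<union> (cube_set Q - E) = cube_set Q"
      using E by blast
    also have "emeasure ?W (cube_set Q) = ennreal ((1 - d) * ?I) + ennreal (d * ?I)"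
    proof -
      have "(1 - d) * ?I \<ge> 0" "d * ?I \<ge> 0" "(1 - d) * ?I + d * ?I = ?I"
        using d I0 by (auto simp: left_diff_distrib intro: mult_left_le_one_le)
      then show ?thesis
        unfolding emeasure_weight_cube(1)[OF w Q] by (metis ennreal_plus)
    qed
    finally have "emeasure ?W E \<le> ennreal ((1 - d) * ?I)"
      by (simp add: ennreal_add_left_cancel_le add.commute)
    also have "\<dots> = ennreal (1 - d) * emeasure ?W (cube_set Q)"
      using d by (simp add: emeasure_weight_cube(1)[OF w Q] ennreal_mult')
    finally show "emeasure ?W E \<le> ennreal (1 - d) * emeasure ?W (cube_set Q)" .
  qed
qed

text \<open>Almost everywhere on Q the weight is at least its average divided by \<open>C'\<close>;
  integrating over a set of at least half the measure gives the share 1 / (2 C').\<close>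

lemma A1_halving:
  fixes w :: "real^'n::finite \<Rightarrow> real"
  assumes "A1 w"
  shows "\<exists>\<theta>\<ge>0. \<theta> < 1 \<and> halving \<theta> w"
proof -
  from assms obtain C where w: "weight w"
    and C: "\<And>Q. is_cube Q \<Longrightarrow> AE x in lebesgue. x \<in> cube_set Q \<longrightarrow> avg Q w \<le> C * w x"
    unfolding A1_def by blast
  define C' where "C' = max C 1"
  have C': "C' \<ge> C" "C' > 0"
    by (auto simp: C'_def)
  show ?thesis
  proof (rule halving_of_lower_bound[OF w])
    show "1 / (2 * C') > 0"
      using C' by simp
    fix Q :: "'n cube" and F
    assume Q: "is_cube Q" and F: "F \<in> sets lebesgue" "F \<subseteq> cube_set Q"
      and half: "measure lebesgue (cube_set Q) \<le> 2 * measure lebesgue F"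
    have a0: "avg Q w \<ge> 0"
      by (rule emeasure_weight_cube(2)[OF w Q])
    have finF: "emeasure lebesgue F \<noteq> top"
      using emeasure_mono[OF F(2) cube_set_lebesgue] emeasure_cube_set[OF Q]
      by (metis ennreal_neq_top top.extremum_unique)
    have "AE x in lebesgue. x \<in> F \<longrightarrow> avg Q w / C' \<le> w x"
      using C[OF Q]
    proof eventually_elim
      case (elim x)
      show ?case
      proof
        assume "x \<in> F"
        then have "avg Q w \<le> C * w x"
          using elim F by blast
        also have "\<dots> \<le> C' * w x"
          using C' w unfolding weight_def by (intro mult_right_mono) auto
        finally show "avg Q w / C' \<le> w x"
          using C' by (simp add: pos_divide_le_eq mult.commute)
      qed
    qed
    then have "ennreal (avg Q w / C' * measure lebesgue F) \<le> emeasure (weight_measure w) F"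
      using a0 C' by (intro emeasure_weight_ge[OF w F(1) order_refl F(1) finF]) auto
    moreover have "1 / (2 * C') * (avg Q w * snd Q ^ CARD('n)) \<le> avg Q w / C' * measure lebesgue F"
    proof -
      have "avg Q w / (2 * C') * measure lebesgue (cube_set Q) \<le> avg Q w / (2 * C') * (2 * measure lebesgue F)"
        using a0 C' half by (intro mult_left_mono) auto
      then show ?thesis
        by (simp add: measure_cube_set[OF Q])
    qed
    ultimately show "ennreal (1 / (2 * C') * (avg Q w * snd Q ^ CARD('n))) \<le> emeasure (weight_measure w) F"
      by (meson ennreal_leI order_trans)
  qed
qed

text \<open>Instead of the usual Hoelder argument, Chebyshev's inequality for the dual weight shows that w
  is bounded below by a multiple of its average on three quarters of the cube.\<close>

lemma Ap_halving:
  fixes w :: "real^'n::finite \<Rightarrow> real"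
  assumes "Ap p w"
  shows "\<exists>\<theta>\<ge>0. \<theta> < 1 \<and> halving \<theta> w"
proof -
  define \<sigma> where "\<sigma> x = w x powr (- 1 / (p - 1))" for x
  from assms obtain C where p: "p > 1" and w: "weight w"
    and int: "\<And>Q. is_cube Q \<Longrightarrow> set_integrable lebesgue (cube_set Q) \<sigma>"
    and C: "\<And>Q. is_cube Q \<Longrightarrow> avg Q w * (avg Q \<sigma>) powr (p - 1) \<le> C"
    unfolding Ap_def \<sigma>_def by blast
  define C' where "C' = max C 1"
  have C': "C' \<ge> C" "C' > 0"
    by (auto simp: C'_def)
  have [measurable]: "w \<in> borel_measurable lebesgue"
    using w by (rule weight_measurable)
  have w0: "w x \<ge> 0" for x
    using w unfolding weight_def by blast
  have wpos: "AE x in lebesgue. w x > 0"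
    using w unfolding weight_def by blast
  have \<sigma>_meas [measurable]: "\<sigma> \<in> borel_measurable lebesgue"
    unfolding \<sigma>_def[abs_def] by measurable
  have weight_\<sigma>: "weight \<sigma>"
    unfolding weight_def
  proof (intro conjI allI impI int)
    show "AE x in lebesgue. \<sigma> x > 0"
      using wpos by eventually_elim (simp add: \<sigma>_def)
  qed (auto simp: \<sigma>_def)
  show ?thesis
  proof (rule halving_of_lower_bound[OF w])
    \<comment> \<open>The quarter is the proportion of Q left in F - H, the power of 4 comes from
      the threshold \<open>u\<close>, and C' from the A_p condition.\<close>
    show "4 powr (- (p - 1)) / (4 * C') > 0"
      using C' by simp
    fix Q :: "'n cube" and F
    assume Q: "is_cube Q" and F: "F \<in> sets lebesgue" "F \<subseteq> cube_set Q"
      and half: "measure lebesgue (cube_set Q) \<le> 2 * measure lebesgue F"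
    define A where "A = avg Q \<sigma>"
    define V where "V = snd Q ^ CARD('n)"
    have V: "V > 0" "emeasure lebesgue (cube_set Q) = ennreal V" "measure lebesgue (cube_set Q) = V"
      using Q emeasure_cube_set[OF Q] measure_cube_set[OF Q] unfolding V_def is_cube_def by auto
    have dual: "emeasure (weight_measure \<sigma>) (cube_set Q) = ennreal (A * V)"
      unfolding A_def V_def by (rule emeasure_weight_cube(1)[OF weight_\<sigma> Q])
    have A: "A > 0"
    proof (rule ccontr)
      assume "\<not> A > 0"
      then have "A = 0"
        using emeasure_weight_cube(2)[OF weight_\<sigma> Q] by (simp add: A_def)
      then have "(\<integral>\<^sup>+x. ennreal (\<sigma> x) * indicator (cube_set Q) x \<partial>lebesgue) = 0"
        using dual by (subst (asm) emeasure_density) auto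
      then have "AE x in lebesgue. ennreal (\<sigma> x) * indicator (cube_set Q) x = 0"
        by (subst (asm) nn_integral_0_iff_AE) auto
      then have "AE x in lebesgue. x \<notin> cube_set Q"
        using wpos
        by eventually_elim (auto simp: \<sigma>_def split: split_indicator_asm)
      then have "emeasure lebesgue (cube_set Q) = 0"
        by (subst (asm) AE_iff_measurable[OF cube_set_lebesgue]) auto
      then show False
        using V by simp
    qed
    \<comment> \<open>At four times the average, Chebyshev leaves at most a quarter of Q in
      \<open>H\<close>, so a set F filling half of Q keeps a quarter outside
      \<open>H\<close>.\<close>
    define u where "u = 4 * A"
    have u: "u > 0"
      using A by (simp add: u_def)
    define H where "H = {x \<in> cube_set Q. u \<le> \<sigma> x}"
    have [measurable]: "H \<in> sets lebesgue"
    proof -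
      have "H = cube_set Q \<inter> {x \<in> space lebesgue. u \<le> \<sigma> x}"
        by (auto simp: H_def)
      then show ?thesis
        by simp
    qed
    have fin: "emeasure lebesgue X \<noteq> top" if "X \<subseteq> cube_set Q" for X
      using emeasure_mono[OF that cube_set_lebesgue] V(2)
      by (metis ennreal_neq_top top.extremum_unique)
    have HQ: "H \<subseteq> cube_set Q"
      by (auto simp: H_def)
    have finH: "emeasure lebesgue H \<noteq> top" and finF: "emeasure lebesgue F \<noteq> top"
      by (rule fin[OF HQ], rule fin[OF F(2)])
    have "ennreal (u * measure lebesgue H) \<le> ennreal (A * V)"
      unfolding dual[symmetric] using u
      by (intro emeasure_weight_ge[OF weight_\<sigma> _ HQ _ finH]) (auto simp: H_def)
    then have "u * measure lebesgue H \<le> A * V"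
      using A V by (simp add: ennreal_le_iff)
    then have mH: "measure lebesgue H \<le> V / 4"
      using A by (simp add: u_def)
    have "measure lebesgue F \<le> measure lebesgue ((F - H) \<union> H)"
      using F finF finH by (intro measure_mono_fmeasurable fmeasurable.Un fmeasurable.Diff)
        (auto simp: fmeasurable_def less_top)
    also have "\<dots> \<le> measure lebesgue (F - H) + measure lebesgue H"
      using F by (intro measure_Un_le) auto
    finally have mG: "V / 4 \<le> measure lebesgue (F - H)"
      using mH half V(3) by linarith
    have finG: "emeasure lebesgue (F - H) \<noteq> top"
      using F(2) by (intro fin) auto
    define v where "v = u powr (- (p - 1))"
    have "AE x in lebesgue. x \<in> F - H \<longrightarrow> v \<le> w x"
      using wpos
    proof eventually_elim
      case (elim x)
      show ?case
      proof
        assume "x \<in> F - H"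
        then have "\<sigma> x < u"
          using F by (auto simp: H_def)
        moreover have "\<sigma> x > 0"
          using elim by (simp add: \<sigma>_def)
        ultimately have "v \<le> \<sigma> x powr (- (p - 1))"
          unfolding v_def using p by (intro powr_mono2') auto
        also have "\<dots> = w x"
        proof -
          have "(- 1 / (p - 1)) * (- (p - 1)) = 1"
            using p by (simp add: divide_eq_minus_1_iff)
          then show ?thesis
            using elim unfolding \<sigma>_def powr_powr by simp
        qed
        finally show "v \<le> w x" .
      qed
    qed
    then have "ennreal (v * measure lebesgue (F - H)) \<le> emeasure (weight_measure w) F"
      by (intro emeasure_weight_ge[OF w _ _ F(1) finG]) (use F in \<open>auto simp: v_def\<close>)
    moreover have "4 powr (- (p - 1)) / (4 * C') * (avg Q w * V) \<le> v * measure lebesgue (F - H)"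
    proof -
      have "avg Q w * A powr (p - 1) \<le> C'"
        using C[OF Q] C' unfolding A_def by linarith
      then have "avg Q w \<le> C' * A powr (- (p - 1))"
        using A by (simp only: powr_minus divide_inverse[symmetric] pos_le_divide_eq powr_gt_zero)
      then have "4 powr (- (p - 1)) / (4 * C') * (avg Q w * V)
          \<le> 4 powr (- (p - 1)) / (4 * C') * (C' * A powr (- (p - 1)) * V)"
        using C' V by (intro mult_left_mono mult_right_mono) auto
      also have "\<dots> = v * (V / 4)"
        using C' A by (simp add: v_def u_def powr_mult)
      also have "\<dots> \<le> v * measure lebesgue (F - H)"
        using mG by (intro mult_left_mono) (auto simp: v_def)
      finally show ?thesis .
    qed
    ultimately show "ennreal (4 powr (- (p - 1)) / (4 * C') * (avg Q w * snd Q ^ CARD('n)))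
        \<le> emeasure (weight_measure w) F"
      unfolding V_def[symmetric] by (meson ennreal_leI order_trans)
  qed
qed

lemma A_inf_weight: "A_inf w \<Longrightarrow> weight w"
  unfolding A_inf_def A1_def Ap_def by blast

lemma A_inf_halving: "A_inf w \<Longrightarrow> \<exists>\<theta>\<ge>0. \<theta> < 1 \<and> halving \<theta> w"
  unfolding A_inf_def using A1_halving Ap_halving by blast

text \<open>Makes the unweighted estimate an instance of the weighted one.\<close>

lemma halving_const: "halving (1 / 2) (\<lambda>_::real^'n::finite. 1)"
  unfolding halving_def
proof (intro allI impI)
  fix Q :: "'n cube" and E :: "(real^'n) set"
  assume "2 * emeasure lebesgue E \<le> emeasure lebesgue (cube_set Q)"
  then have "ennreal (1 / 2) * (2 * emeasure lebesgue E) \<le> ennreal (1 / 2) * emeasure lebesgue (cube_set Q)"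
    by (rule mult_left_mono) simp
  moreover have "ennreal (1 / 2) * (2 * emeasure lebesgue E) = emeasure lebesgue E"
  proof -
    have "ennreal (1 / 2) * 2 = 1"
      using ennreal_mult'[of "1 / 2" 2] by simp
    then show ?thesis
      by (simp add: mult.assoc[symmetric])
  qed
  ultimately show "emeasure (weight_measure (\<lambda>_. 1)) E
      \<le> ennreal (1 / 2) * emeasure (weight_measure (\<lambda>_. 1)) (cube_set Q)"
    by (simp only: ennreal_1 density_1)
qed

subsection \<open>Exponential integrability\<close>

text \<open>A discrete layer-cake formula with steps of height M. The choice of t makes exp (M / t)
  equal to s = 2 / (1 + \<theta>), so each step multiplies the exponential by s while the tail
  shrinks by \<theta>. The result is a geometric series of ratio s \<theta> < 1.\<close>

lemma exp_integral_le_of_tail: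
  fixes g w :: "real^'n::finite \<Rightarrow> real" and M :: real
  assumes w: "weight w" and g: "g \<in> borel_measurable lebesgue"
    and \<theta>: "0 \<le> \<theta>" "\<theta> < 1" and M: "M > 0"
    and tail: "\<And>N::nat. emeasure (weight_measure w) {x \<in> cube_set Q. real N * M < \<bar>g x\<bar>}
        \<le> ennreal (\<theta> ^ N) * emeasure (weight_measure w) (cube_set Q)"
  defines "t \<equiv> M / ln (2 / (1 + \<theta>))"
  shows "(\<integral>\<^sup>+x\<in>cube_set Q. ennreal ((exp (\<bar>g x\<bar> / t) - 1) * w x) \<partial>lebesgue)
    \<le> (\<integral>\<^sup>+x\<in>cube_set Q. ennreal (w x) \<partial>lebesgue)"
proof -
  have [measurable]: "w \<in> borel_measurable lebesgue" "g \<in> borel_measurable lebesgue"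
    using w g by (auto intro: weight_measurable)
  have w0: "w x \<ge> 0" for x
    using w unfolding weight_def by blast
  let ?W = "weight_measure w"
  \<comment> \<open>The solution of s - 1 = 1 - s \<theta>: with it the geometric series below sums
    to exactly 1, the bound in the Luxemburg norm.\<close>
  define s where "s = 2 / (1 + \<theta>)"
  have s: "s > 1" "s * \<theta> < 1" "s * \<theta> \<ge> 0"
    using \<theta> by (auto simp: s_def field_simps)
  have lns: "ln s > 0"
    using s by simp
  define E where "E N = {x \<in> cube_set Q. real N * M < \<bar>g x\<bar>}" for N :: nat
  have E_meas [measurable]: "E N \<in> sets lebesgue" for N
  proof -
    have "E N = cube_set Q \<inter> {x \<in> space lebesgue. real N * M < \<bar>g x\<bar>}"
      by (auto simp: E_def)
    then show ?thesis
      by simp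
  qed
  have pointwise: "ennreal (exp (\<bar>g x\<bar> / t) - 1) * indicator (cube_set Q) x
      \<le> (\<Sum>N. ennreal (s ^ N * (s - 1)) * indicator (E N) x)" for x
  proof (cases "x \<in> cube_set Q")
    case True
    \<comment> \<open>With the ceiling, N < K holds exactly when |g x| > N M, so the levels passed
      are those N with x in \<open>E N\<close>.\<close>
    define K where "K = nat \<lceil>\<bar>g x\<bar> / M\<rceil>"
    have K: "\<bar>g x\<bar> / M \<le> real K"
      unfolding K_def by (rule of_nat_ceiling)
    have "exp (\<bar>g x\<bar> / t) = exp (ln s * (\<bar>g x\<bar> / M))"
      by (simp add: t_def s_def[symmetric] mult.commute)
    also have "\<dots> \<le> exp (ln s * real K)"
      using mult_left_mono[OF K less_imp_le[OF lns]] by simp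
    also have "\<dots> = s ^ K"
      using s by (simp add: exp_of_nat2_mult)
    finally have "exp (\<bar>g x\<bar> / t) - 1 \<le> s ^ K - 1"
      by simp
    \<comment> \<open>Telescoping: the summand is the growth of s^N from N to N + 1.\<close>
    also have "\<dots> = (\<Sum>N<K. s ^ N * (s - 1))"
      by (simp add: power_diff_1_eq sum_distrib_left mult.commute)
    finally have "ennreal (exp (\<bar>g x\<bar> / t) - 1) \<le> ennreal (\<Sum>N<K. s ^ N * (s - 1))"
      by (rule ennreal_leI)
    also have "\<dots> = (\<Sum>N<K. ennreal (s ^ N * (s - 1)))"
      using s by (intro sum_ennreal[symmetric]) auto
    also have "\<dots> = (\<Sum>N<K. ennreal (s ^ N * (s - 1)) * indicator (E N) x)"
    proof (rule sum.cong)
      fix N assume "N \<in> {..<K}"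
      then have "int N < \<lceil>\<bar>g x\<bar> / M\<rceil>"
        by (auto simp: K_def)
      then have "real N < \<bar>g x\<bar> / M"
        by (metis less_ceiling_iff of_int_of_nat_eq)
      then have "x \<in> E N"
        using M True by (simp add: E_def pos_less_divide_eq)
      then show "ennreal (s ^ N * (s - 1)) = ennreal (s ^ N * (s - 1)) * indicator (E N) x"
        by simp
    qed simp
    also have "\<dots> \<le> (\<Sum>N. ennreal (s ^ N * (s - 1)) * indicator (E N) x)"
      by (intro sum_le_suminf summableI) auto
    finally show ?thesis
      using True by simp
  qed simp
  have "(\<integral>\<^sup>+x\<in>cube_set Q. ennreal ((exp (\<bar>g x\<bar> / t) - 1) * w x) \<partial>lebesgue)
      = (\<integral>\<^sup>+x. ennreal (w x) * (ennreal (exp (\<bar>g x\<bar> / t) - 1) * indicator (cube_set Q) x) \<partial>lebesgue)"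
    by (intro nn_integral_cong) (simp only: ennreal_mult'[OF w0] mult_ac)
  also have "\<dots> = (\<integral>\<^sup>+x. ennreal (exp (\<bar>g x\<bar> / t) - 1) * indicator (cube_set Q) x \<partial>?W)"
    by (rule nn_integral_density[symmetric]) auto
  also have "\<dots> \<le> (\<integral>\<^sup>+x. (\<Sum>N. ennreal (s ^ N * (s - 1)) * indicator (E N) x) \<partial>?W)"
    by (rule nn_integral_mono) (rule pointwise)
  also have "\<dots> = (\<Sum>N. \<integral>\<^sup>+x. ennreal (s ^ N * (s - 1)) * indicator (E N) x \<partial>?W)"
    by (rule nn_integral_suminf) auto
  also have "\<dots> = (\<Sum>N. ennreal (s ^ N * (s - 1)) * emeasure ?W (E N))"
    by (simp add: nn_integral_cmult)
  also have "\<dots> \<le> (\<Sum>N. ennreal ((s * \<theta>) ^ N * (s - 1)) * emeasure ?W (cube_set Q))"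
  proof (intro suminf_le summableI)
    fix N
    have "ennreal (s ^ N * (s - 1)) * emeasure ?W (E N)
        \<le> ennreal (s ^ N * (s - 1)) * (ennreal (\<theta> ^ N) * emeasure ?W (cube_set Q))"
      unfolding E_def by (intro mult_left_mono tail) simp
    also have "\<dots> = ennreal (s ^ N * (s - 1) * \<theta> ^ N) * emeasure ?W (cube_set Q)"
      using s \<theta> by (simp add: ennreal_mult'' mult.assoc)
    also have "s ^ N * (s - 1) * \<theta> ^ N = (s * \<theta>) ^ N * (s - 1)"
      by (simp add: power_mult_distrib mult_ac)
    finally show "ennreal (s ^ N * (s - 1)) * emeasure ?W (E N)
        \<le> ennreal ((s * \<theta>) ^ N * (s - 1)) * emeasure ?W (cube_set Q)" .
  qed
  also have "\<dots> = (\<Sum>N. ennreal ((s * \<theta>) ^ N * (s - 1))) * emeasure ?W (cube_set Q)"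
    by (rule ennreal_suminf_multc)
  also have "(\<Sum>N. ennreal ((s * \<theta>) ^ N * (s - 1))) = ennreal 1"
  proof (rule suminf_ennreal_eq)
    have "(\<lambda>N. (s * \<theta>) ^ N * (s - 1)) sums (1 / (1 - s * \<theta>) * (s - 1))"
      using s by (intro sums_mult2 geometric_sums) auto
    also have "1 / (1 - s * \<theta>) * (s - 1) = 1"
    proof -
      have "1 - s * \<theta> = s - 1"
        using \<theta> by (simp add: s_def field_simps)
      then show ?thesis
        using s(1) by simp
    qed
    finally show "(\<lambda>N. (s * \<theta>) ^ N * (s - 1)) sums 1" .
  qed (use s in auto)
  also have "ennreal 1 * emeasure ?W (cube_set Q) = (\<integral>\<^sup>+x\<in>cube_set Q. ennreal (w x) \<partial>lebesgue)"
    by (simp add: emeasure_density)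
  finally show ?thesis .
qed

section \<open>Iteration of the decomposition and the Luxemburg norm\<close>

context O_ops_functional
begin

text \<open>The threshold is fixed by Q while R ranges over all cubes in Q, so the induction
  hypothesis applies to the stopping cubes of R. Up to a null set, exceeding N + 1 steps on R forces
  exceeding N steps on one of them. These are disjoint and carry at most the fraction \<theta> of
  the weight of R.\<close>

lemma tail_decay:
  assumes w: "w \<in> borel_measurable lebesgue" and \<theta>: "0 \<le> \<theta>" "halving \<theta> w"
    and Q: "is_cube Q" and T: "eta_sum \<alpha> a Q \<le> ennreal T" "T > 0"
    and R: "is_cube R" "cube_set R \<subseteq> cube_set Q"
  shows "emeasure (weight_measure w) {x \<in> cube_set R. real N * (jump Ca * (Ca * T)) < \<bar>B R f x\<bar>}
    \<le> ennreal (\<theta> ^ N) * emeasure (weight_measure w) (cube_set R)"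
  using R
proof (induction N arbitrary: R)
  case 0
  have "emeasure (weight_measure w) {x \<in> cube_set R. real 0 * (jump Ca * (Ca * T)) < \<bar>B R f x\<bar>}
      \<le> emeasure (weight_measure w) (cube_set R)"
    by (rule emeasure_mono) auto
  then show ?case
    by simp
next
  case (Suc N)
  let ?W = "weight_measure w"
  let ?M = "jump Ca * (Ca * T)"
  define E where "E R N = {x \<in> cube_set R. real N * ?M < \<bar>B R f x\<bar>}" for R and N :: nat
  have [measurable]: "w \<in> borel_measurable lebesgue"
    by (rule w)
  have E_meas: "E R N \<in> sets lebesgue" if "is_cube R" for R N
  proof -
    have [measurable]: "B R f \<in> borel_measurable lebesgue"
      by (intro Lloc_measurable[OF Lloc_B] that f)
    have "E R N = cube_set R \<inter> {x \<in> space lebesgue. real N * ?M < \<bar>B R f x\<bar>}"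
      by (auto simp: E_def)
    then show ?thesis
      by simp
  qed
  have M: "?M > 0"
    using jump_pos[of Ca] Ca T(2) by simp
  \<comment> \<open>R is compared with the original Q, not with its predecessor in the iteration, so
    only one factor Ca appears.\<close>
  have "eta_sum \<alpha> a R \<le> ennreal Ca * eta_sum \<alpha> a Q"
    by (rule eta_sum_mono[OF Q Suc.prems])
  also have "\<dots> \<le> ennreal Ca * ennreal T"
    by (rule mult_left_mono[OF T(1)]) simp
  also have "\<dots> = ennreal (Ca * T)"
    using Ca by (simp add: ennreal_mult')
  finally have TR: "eta_sum \<alpha> a R \<le> ennreal (Ca * T)" .
  have TR': "Ca * T > 0"
    using Ca T(2) by simp
  obtain D where D: "countable D" "disjoint_family_on cube_set D"
    and sub: "\<And>P. P \<in> D \<Longrightarrow> is_cube P \<and> cube_set P \<subseteq> cube_set R"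
    and half: "2 * emeasure lebesgue (\<Union>P\<in>D. cube_set P) \<le> emeasure lebesgue (cube_set R)"
    and off: "AE y in lebesgue. y \<in> cube_set R - (\<Union>P\<in>D. cube_set P) \<longrightarrow> \<bar>B R f y\<bar> \<le> ?M"
    and on: "\<And>P. P \<in> D \<Longrightarrow>
      AE y in lebesgue. y \<in> cube_set P \<longrightarrow> \<bar>B R f y\<bar> \<le> \<bar>B P f y\<bar> + ?M"
    by (rule stopping_decomposition[OF Suc.prems(1) TR TR']) blast
  have "AE y in lebesgue. \<forall>P\<in>D. y \<in> cube_set P \<longrightarrow> \<bar>B R f y\<bar> \<le> \<bar>B P f y\<bar> + ?M"
    using D(1) on by (simp add: AE_ball_countable)
  then have "AE y in lebesgue. y \<in> E R (Suc N) \<longrightarrow> y \<in> (\<Union>P\<in>D. E P N)"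
    using off
  proof eventually_elim
    case (elim y)
    show ?case
    proof
      assume "y \<in> E R (Suc N)"
      then have y: "y \<in> cube_set R" "real N * ?M + ?M < \<bar>B R f y\<bar>"
        by (auto simp: E_def distrib_right)
      \<comment> \<open>Off the stopping cubes |B_R f| is at most one step, so y, which exceeds N +
        1 steps, lies in one of them.\<close>
      have "real N * ?M \<ge> 0"
        using M by simp
      then have "\<not> \<bar>B R f y\<bar> \<le> ?M"
        using y(2) by linarith
      then obtain P where P: "P \<in> D" "y \<in> cube_set P"
        using elim(2) y(1) by blast
      then have "\<bar>B R f y\<bar> \<le> \<bar>B P f y\<bar> + ?M"
        using elim(1) by blast
      then have "y \<in> E P N"
        using y(2) P(2) by (simp add: E_def)
      then show "y \<in> (\<Union>P\<in>D. E P N)"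
        using P(1) by blast
    qed
  qed
  \<comment> \<open>Lebesgue null sets are null for the weighted measure.\<close>
  then have AE_sub: "AE y in ?W. y \<in> E R (Suc N) \<longrightarrow> y \<in> (\<Union>P\<in>D. E P N)"
    by (subst AE_density) (auto elim: eventually_mono)
  have "emeasure ?W (E R (Suc N)) \<le> emeasure ?W (\<Union>P\<in>D. E P N)"
    using D(1) sub E_meas
    by (intro emeasure_mono_AE[OF AE_sub]) (auto intro!: sets.countable_UN')
  also have "\<dots> \<le> (\<integral>\<^sup>+P. emeasure ?W (E P N) \<partial>count_space D)"
    using D(1) sub E_meas by (intro emeasure_UN_countable_le) auto
  also have "\<dots> \<le> (\<integral>\<^sup>+P. ennreal (\<theta> ^ N) * emeasure ?W (cube_set P) \<partial>count_space D)"
  proof (rule nn_integral_mono)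
    fix P assume "P \<in> space (count_space D)"
    then have "P \<in> D"
      by simp
    then have "is_cube P" "cube_set P \<subseteq> cube_set Q"
      using sub[of P] Suc.prems(2) by blast+
    then show "emeasure ?W (E P N) \<le> ennreal (\<theta> ^ N) * emeasure ?W (cube_set P)"
      unfolding E_def by (rule Suc.IH)
  qed
  also have "\<dots> = ennreal (\<theta> ^ N) * (\<integral>\<^sup>+P. emeasure ?W (cube_set P) \<partial>count_space D)"
    by (rule nn_integral_cmult) simp
  also have "(\<integral>\<^sup>+P. emeasure ?W (cube_set P) \<partial>count_space D) = emeasure ?W (\<Union>P\<in>D. cube_set P)"
    using D by (intro emeasure_UN_countable[symmetric]) auto
  also have "ennreal (\<theta> ^ N) * emeasure ?W (\<Union>P\<in>D. cube_set P)
      \<le> ennreal (\<theta> ^ N) * (ennreal \<theta> * emeasure ?W (cube_set R))"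
  proof (rule mult_left_mono)
    show "emeasure ?W (\<Union>P\<in>D. cube_set P) \<le> ennreal \<theta> * emeasure ?W (cube_set R)"
    proof (rule halvingD[OF \<theta>(2) Suc.prems(1) _ _ half])
      show "(\<Union>P\<in>D. cube_set P) \<in> sets lebesgue"
        using D(1) by (intro sets.countable_UN') auto
      show "(\<Union>P\<in>D. cube_set P) \<subseteq> cube_set R"
        using sub by blast
    qed
  qed simp
  also have "\<dots> = ennreal (\<theta> ^ Suc N) * emeasure ?W (cube_set R)"
    using \<theta>(1) by (simp add: ennreal_mult'' mult_ac)
  finally show ?case
    unfolding E_def .
qed

text \<open>The decomposition needs a finite positive T, whereas the series may be 0 or infinite.
  Hence the bound is proved for each admissible T above the series and then carried over to the
  series itself.\<close>

lemma expLw_norm_le: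
  assumes w: "weight w" and \<theta>: "0 \<le> \<theta>" "\<theta> < 1" "halving \<theta> w" and Q: "is_cube Q"
  shows "expLw_norm w Q (B Q f)
    \<le> ennreal (jump Ca * Ca / ln (2 / (1 + \<theta>))) * eta_sum \<alpha> a Q"
proof -
  define C where "C = jump Ca * Ca / ln (2 / (1 + \<theta>))"
  have lns: "ln (2 / (1 + \<theta>)) > 0"
    using \<theta> by simp
  have C: "C > 0"
    using jump_pos[of Ca] Ca lns by (simp add: C_def)
  have bound: "expLw_norm w Q (B Q f) \<le> ennreal (C * T)" if T: "eta_sum \<alpha> a Q \<le> ennreal T" "T > 0" for T
  proof -
    have "jump Ca * (Ca * T) > 0"
      using jump_pos[of Ca] Ca T(2) by simp
    then have "(\<integral>\<^sup>+x\<in>cube_set Q. ennreal ((exp (\<bar>B Q f x\<bar> / (jump Ca * (Ca * T) / ln (2 / (1 + \<theta>)))) - 1) * w x) \<partial>lebesgue)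
        \<le> (\<integral>\<^sup>+x\<in>cube_set Q. ennreal (w x) \<partial>lebesgue)"
      using tail_decay[OF weight_measurable[OF w] \<theta>(1,3) Q T Q order_refl]
      by (intro exp_integral_le_of_tail[OF w _ \<theta>(1,2)] Lloc_measurable[OF Lloc_B[OF Q f]])
    moreover have "jump Ca * (Ca * T) / ln (2 / (1 + \<theta>)) = C * T"
      by (simp add: C_def)
    moreover have "C * T > 0"
      using C T(2) by simp
    ultimately show ?thesis
      unfolding expLw_norm_def by (intro Inf_lower) auto
  qed
  show ?thesis
  proof (cases "eta_sum \<alpha> a Q")
    case (real r)
    show ?thesis
      unfolding C_def[symmetric]
    proof (rule ennreal_le_epsilon)
      fix e :: real assume e: "e > 0"
      \<comment> \<open>The increment e / C makes T positive even when r = 0 and contributes exactly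
        e.\<close>
      have "expLw_norm w Q (B Q f) \<le> ennreal (C * (r + e / C))"
        using real C e by (intro bound) (auto intro!: ennreal_leI add_nonneg_pos)
      also have "C * (r + e / C) = C * r + e"
        using C by (simp add: distrib_left)
      also have "ennreal (C * r + e) = ennreal C * eta_sum \<alpha> a Q + ennreal e"
        using real C e by (simp add: ennreal_mult')
      finally show "expLw_norm w Q (B Q f) \<le> ennreal C * eta_sum \<alpha> a Q + ennreal e" .
    qed
  next
    case top
    then show ?thesis
      using C unfolding C_def[symmetric] by (simp add: ennreal_mult_top)
  qed
qed

end

section \<open>The unweighted case and the conclusion\<close>

lemma expLw_norm_const: "expLw_norm (\<lambda>_. 1) Q g = expL_norm Q g"
proof -
  have "(\<integral>\<^sup>+x\<in>cube_set Q. ennreal 1 \<partial>lebesgue) = emeasure lebesgue (cube_set Q)"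
    using nn_integral_indicator[OF cube_set_lebesgue[of Q]] by simp
  then show ?thesis
    by (simp only: expLw_norm_def expL_norm_def mult_1_right)
qed

lemma weight_const: "weight (\<lambda>_::real^'n::finite. 1)"
  unfolding weight_def
proof (intro conjI allI impI)
  fix Q :: "'n cube"
  assume "is_cube Q"
  then show "set_integrable lebesgue (cube_set Q) (\<lambda>_. 1 :: real)"
    unfolding set_integrable_def
    using emeasure_cube_set[of Q] integrable_real_indicator[OF cube_set_lebesgue[of Q]] by simp
qed auto

theorem mainTheorem8:
  fixes p0 :: real
    and B :: "'n::finite cube \<Rightarrow> (real^'n \<Rightarrow> real) \<Rightarrow> (real^'n \<Rightarrow> real)"
    and \<alpha> \<beta> :: "nat \<Rightarrow> real"
    and Ca :: real
  assumes "1 \<le> p0"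
    and "O_class p0 B \<alpha> \<beta>"
    and "1 \<le> Ca"
  shows "(\<exists>C::real. \<forall>f a. Lloc p0 f \<longrightarrow> D_inf_const Ca a \<longrightarrow>
            (\<forall>Q k. is_cube Q \<longrightarrow> avgp p0 (dil (2 ^ k) Q) (B Q f) \<le> a (dil (2 ^ k) Q)) \<longrightarrow>
            (\<forall>Q. is_cube Q \<longrightarrow>
               expL_norm Q (B Q f) \<le> ennreal C * (\<Sum>k. ennreal (eta \<alpha> (k + 1) * a (dil (2 ^ (k + 1)) Q)))))
       \<and> (\<forall>w. A_inf w \<longrightarrow>
          (\<exists>Cw::real. \<forall>f a. Lloc p0 f \<longrightarrow> D_inf_const Ca a \<longrightarrow>
            (\<forall>Q k. is_cube Q \<longrightarrow> avgp p0 (dil (2 ^ k) Q) (B Q f) \<le> a (dil (2 ^ k) Q)) \<longrightarrow>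
            (\<forall>Q. is_cube Q \<longrightarrow>
               expLw_norm w Q (B Q f) \<le> ennreal Cw * (\<Sum>k. ennreal (eta \<alpha> (k + 1) * a (dil (2 ^ (k + 1)) Q))))))"
proof (intro conjI allI impI)
  interpret O_ops p0 B \<alpha> \<beta>
    using assms(1,2) by unfold_locales
  \<comment> \<open>The constant of \<open>expLw_norm_le\<close> involves w only through \<theta>,
    and f and a only through Ca, so it can be chosen before f, a and Q.\<close>
  have main: "\<exists>C::real. \<forall>f a. Lloc p0 f \<longrightarrow> D_inf_const Ca a \<longrightarrow>
            (\<forall>Q k. is_cube Q \<longrightarrow> avgp p0 (dil (2 ^ k) Q) (B Q f) \<le> a (dil (2 ^ k) Q)) \<longrightarrow>
            (\<forall>Q. is_cube Q \<longrightarrow>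
               expLw_norm w Q (B Q f) \<le> ennreal C * (\<Sum>k. ennreal (eta \<alpha> (k + 1) * a (dil (2 ^ (k + 1)) Q))))"
    if "weight w" "0 \<le> \<theta>" "\<theta> < 1" "halving \<theta> w" for w \<theta>
  proof (intro exI allI impI)
    fix f a and Q :: "'n cube"
    assume "Lloc p0 f" "D_inf_const Ca a"
      "\<forall>Q k. is_cube Q \<longrightarrow> avgp p0 (dil (2 ^ k) Q) (B Q f) \<le> a (dil (2 ^ k) Q)"
      and Q: "is_cube Q"
    then interpret O_ops_functional p0 B \<alpha> \<beta> f a Ca
      by unfold_locales auto
    show "expLw_norm w Q (B Q f) \<le> ennreal (jump Ca * Ca / ln (2 / (1 + \<theta>)))
        * (\<Sum>k. ennreal (eta \<alpha> (k + 1) * a (dil (2 ^ (k + 1)) Q)))"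
      using expLw_norm_le[OF that Q] unfolding eta_sum_def .
  qed
  show "\<exists>C::real. \<forall>f a. Lloc p0 f \<longrightarrow> D_inf_const Ca a \<longrightarrow>
            (\<forall>Q k. is_cube Q \<longrightarrow> avgp p0 (dil (2 ^ k) Q) (B Q f) \<le> a (dil (2 ^ k) Q)) \<longrightarrow>
            (\<forall>Q. is_cube Q \<longrightarrow>
               expL_norm Q (B Q f) \<le> ennreal C * (\<Sum>k. ennreal (eta \<alpha> (k + 1) * a (dil (2 ^ (k + 1)) Q))))"
    using main[OF weight_const _ _ halving_const] by (simp only: expLw_norm_const)
  fix w :: "real^'n \<Rightarrow> real"
  assume "A_inf w"
  then show "\<exists>Cw::real. \<forall>f a. Lloc p0 f \<longrightarrow> D_inf_const Ca a \<longrightarrow>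
            (\<forall>Q k. is_cube Q \<longrightarrow> avgp p0 (dil (2 ^ k) Q) (B Q f) \<le> a (dil (2 ^ k) Q)) \<longrightarrow>
            (\<forall>Q. is_cube Q \<longrightarrow>
               expLw_norm w Q (B Q f) \<le> ennreal Cw * (\<Sum>k. ennreal (eta \<alpha> (k + 1) * a (dil (2 ^ (k + 1)) Q))))"
    using A_inf_weight A_inf_halving main by meson
qed

end
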